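(* Let $0\le\delta\le 3/956$ and let $\mathcal{I}$ be a $\delta$-ONI instance with $n$ agents such that $|N^1_1|> n\left(\frac14-\delta\right)/\left(\frac14+\frac{\delta}{3}\right)$. Then Algorithm $\mathtt{approxMMS2}(\mathcal{I},\delta)$ (for every resolution of its arbitrary choices) returns a $\left(\frac34+\delta\right)$-MMS allocation of $\mathcal{I}$.
   Context: An instance has agents $N=[n]$, goods $M$, additive valuations $v_i:2^M\to\mathbb{R}_{\ge0}$; $\mathrm{MMS}^d_v(S)$ is the max over partitions of $S$ into $d$ bundles of the minimum bundle value, $\mathrm{MMS}_i=\mathrm{MMS}^n_{v_i}(M)$; an allocation (disjoint bundles $A_i$) is $\beta$-MMS if $v_i(A_i)\ge\beta\mathrm{MMS}_i$ for all $i$. Ordered: $M=[m]$ and $v_i(1)\ge\dots\ge v_i(m)$ for all $i$. Normalized: every agent $i$ has an MMS partition all of whose $n$ bundles have value exactly $1$ to $i$. For an ordered instance with $n$ agents and threshold $\alpha$: $R^\alpha_2$ is applicable if some agent $i$ has $v_i(\{2n-1,2n,2n+1\})\ge\alpha$, and applying it gives this set to such an agent and removes agent and goods; $R^\alpha_3$ likewise with $\{3n-2,3n-1,3n,3n+1\}$. The instance is $\alpha$-irreducible if for every agent $i$: $v_i(1)<\alpha$, $v_i(\{2n-1,2n,2n+1\})<\alpha$, $v_i(\{3n-2,\dots,3n+1\})<\alpha$, $v_i(\{1,2n+1\})<\alpha$; it is $\delta$-ONI if ordered, normalized and $(3/4+\delta)$-irreducible. Goods with index larger than the number of goods, when referred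 to, are dummy goods of value $0$. For the input instance let $B_k=\{k,2n-k+1\}$ ($k\in[n]$), $N^1=\{i:v_i(B_k)\le1\ \forall k\}$, $N^2=N\setminus N^1$, $N^1_1=\{i\in N^1:v_i(2n+1)\ge\frac14-5\delta\}$, $N^1_2=N^1\setminus N^1_1$; these sets are fixed throughout. Algorithm $\mathtt{approxMMS2}(\mathcal{I},\delta)$, with $\alpha=3/4+\delta$ and "priority" meaning an agent of $N^1_2\cup N^2$ is chosen whenever one qualifies: Phase 1: while some remaining agent $i$ and remaining bag $B_k$ have $v_i(B_k)\ge\alpha$, give such a bag to such an agent (priority) and remove both. After every removal, the remaining goods are re-indexed $1,2,\dots$ in decreasing order of value (common to all agents). Phase 2: while some remaining agent $i$ has $v_i(\{1,2\})\ge\alpha$, give $\{1,2\}$ to such an agent (priority) and remove them. Phase 3: while $R^\alpha_2$ or $R^\alpha_3$ is applicable (w.r.t. the current number of agents), apply the one with the smaller index. Phase 4: let $n'$ be the current number of agents, set $C_k=\{k,2n'-k+1,2n'+k\}$ for $k\in[n']$; for $k=1,\dots,n'$: while no remaining agent values $C_k$ at least $\alpha$, add to $C_k$ an arbitrary remaining good outside $[3n']$; then give $C_k$ to a remaining agent $i$ with $v_i(C_k)\ge\alpha$ (priority) and remove them. *)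

theory Defs
  imports Complex_Main "HOL-Library.FuncSet"
begin

text \<open>An instance is given by the number n of agents (agents are 1..n), the number m of
goods (goods are 1..m) and a valuation v, where v i g is the value of good g to agent i.
Valuations are additive; goods with index outside 1..m are dummy goods of value 0.\<close>

type_synonym valuation = "nat \<Rightarrow> nat \<Rightarrow> real"

definition val :: "nat \<Rightarrow> valuation \<Rightarrow> nat \<Rightarrow> nat set \<Rightarrow> real" where
  "val m v i S = (\<Sum>g\<in>S \<inter> {1..m}. v i g)"

definition MMSd :: "(nat \<Rightarrow> real) \<Rightarrow> nat \<Rightarrow> nat set \<Rightarrow> real" where
  "MMSd u d S = Max {Min ((\<lambda>k. \<Sum>g\<in>{g\<in>S. f g = k}. u g) ` {..<d}) | f. f \<in> Pi S (\<lambda>_. {..<d})}"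

definition MMS :: "nat \<Rightarrow> nat \<Rightarrow> valuation \<Rightarrow> nat \<Rightarrow> real" where
  "MMS n m v i = MMSd (v i) n {1..m}"

definition nonneg_additive :: "nat \<Rightarrow> nat \<Rightarrow> valuation \<Rightarrow> bool" where
  "nonneg_additive n m v \<longleftrightarrow> (\<forall>i\<in>{1..n}. \<forall>g\<in>{1..m}. 0 \<le> v i g)"

definition ordered :: "nat \<Rightarrow> nat \<Rightarrow> valuation \<Rightarrow> bool" where
  "ordered n m v \<longleftrightarrow> (\<forall>i\<in>{1..n}. \<forall>g h. 1 \<le> g \<longrightarrow> g \<le> h \<longrightarrow> h \<le> m \<longrightarrow> v i h \<le> v i g)"

definition normalized :: "nat \<Rightarrow> nat \<Rightarrow> valuation \<Rightarrow> bool" where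
  "normalized n m v \<longleftrightarrow> (\<forall>i\<in>{1..n}. \<exists>f \<in> Pi {1..m} (\<lambda>_. {..<n}).
      Min ((\<lambda>k. \<Sum>g\<in>{g\<in>{1..m}. f g = k}. v i g) ` {..<n}) = MMS n m v i \<and>
      (\<forall>k<n. (\<Sum>g\<in>{g\<in>{1..m}. f g = k}. v i g) = 1))"

definition irreducible :: "nat \<Rightarrow> nat \<Rightarrow> valuation \<Rightarrow> real \<Rightarrow> bool" where
  "irreducible n m v \<alpha> \<longleftrightarrow> (\<forall>i\<in>{1..n}.
      val m v i {1} < \<alpha> \<and>
      val m v i {2*n-1, 2*n, 2*n+1} < \<alpha> \<and>
      val m v i {3*n-2, 3*n-1, 3*n, 3*n+1} < \<alpha> \<and>
      val m v i {1, 2*n+1} < \<alpha>)"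

definition ONI :: "nat \<Rightarrow> nat \<Rightarrow> valuation \<Rightarrow> real \<Rightarrow> bool" where
  "ONI n m v \<delta> \<longleftrightarrow> ordered n m v \<and> normalized n m v \<and> irreducible n m v (3/4 + \<delta>)"

definition is_allocation :: "nat \<Rightarrow> nat \<Rightarrow> (nat \<Rightarrow> nat set) \<Rightarrow> bool" where
  "is_allocation n m A \<longleftrightarrow> (\<forall>i\<in>{1..n}. A i \<subseteq> {1..m}) \<and>
      (\<forall>i\<in>{1..n}. \<forall>j\<in>{1..n}. i \<noteq> j \<longrightarrow> A i \<inter> A j = {})"

definition beta_MMS :: "nat \<Rightarrow> nat \<Rightarrow> valuation \<Rightarrow> real \<Rightarrow> (nat \<Rightarrow> nat set) \<Rightarrow> bool" where
  "beta_MMS n m v \<beta> A \<longleftrightarrow> is_allocation n m A \<and>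
      (\<forall>i\<in>{1..n}. val m v i (A i) \<ge> \<beta> * MMS n m v i)"

definition Bbag :: "nat \<Rightarrow> nat \<Rightarrow> nat \<Rightarrow> nat set" where
  "Bbag n m k = {k, 2*n - k + 1} \<inter> {1..m}"

definition N1 :: "nat \<Rightarrow> nat \<Rightarrow> valuation \<Rightarrow> nat set" where
  "N1 n m v = {i\<in>{1..n}. \<forall>k\<in>{1..n}. val m v i (Bbag n m k) \<le> 1}"

definition N2 :: "nat \<Rightarrow> nat \<Rightarrow> valuation \<Rightarrow> nat set" where
  "N2 n m v = {1..n} - N1 n m v"

definition N11 :: "nat \<Rightarrow> nat \<Rightarrow> valuation \<Rightarrow> real \<Rightarrow> nat set" where
  "N11 n m v \<delta> = {i\<in>N1 n m v. val m v i {2*n+1} \<ge> 1/4 - 5*\<delta>}"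

definition N12 :: "nat \<Rightarrow> nat \<Rightarrow> valuation \<Rightarrow> real \<Rightarrow> nat set" where
  "N12 n m v \<delta> = N1 n m v - N11 n m v \<delta>"

definition prio :: "nat \<Rightarrow> nat \<Rightarrow> valuation \<Rightarrow> real \<Rightarrow> nat set" where
  "prio n m v \<delta> = N12 n m v \<delta> \<union> N2 n m v"

text \<open>Re-indexing: the remaining goods G (original indices) are re-indexed 1,2,...
in the common decreasing order of value, i.e. increasing original index.
goodsAt G J is the set of real goods whose current index lies in J
(indices beyond card G denote dummy goods and are dropped).\<close>

definition goodsAt :: "nat set \<Rightarrow> nat set \<Rightarrow> nat set" where
  "goodsAt G J = {sorted_list_of_set G ! (j - 1) | j. j \<in> J \<and> 1 \<le> j \<and> j \<le> card G}"

record state =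
  phase :: nat                    \<comment> \<open>1..4 = phases, 5 = terminated\<close>
  agents :: "nat set"
  goods :: "nat set"              \<comment> \<open>remaining (free) goods; in phase 4: goods outside [3n']\<close>
  bags :: "nat set"               \<comment> \<open>indices k of remaining bags B_k (phase 1)\<close>
  alloc :: "nat \<Rightarrow> nat set"
  cbags :: "nat \<Rightarrow> nat set"
  np :: nat
  cur :: nat

definition init_state :: "nat \<Rightarrow> nat \<Rightarrow> state" where
  "init_state n m = \<lparr>phase = 1, agents = {1..n}, goods = {1..m}, bags = {1..n},
     alloc = (\<lambda>_. {}), cbags = (\<lambda>_. {}), np = 0, cur = 0\<rparr>"

definition give :: "state \<Rightarrow> nat \<Rightarrow> nat set \<Rightarrow> state" where
  "give s i S = s\<lparr>agents := agents s - {i}, goods := goods s - S, alloc := (alloc s)(i := S)\<rparr>"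

inductive step :: "nat \<Rightarrow> nat \<Rightarrow> valuation \<Rightarrow> real \<Rightarrow> state \<Rightarrow> state \<Rightarrow> bool"
  for n m v \<delta> where
  p1_give: "\<lbrakk> phase s = 1; i \<in> agents s; k \<in> bags s;
      val m v i (Bbag n m k) \<ge> 3/4 + \<delta>;
      (\<exists>i'\<in>agents s \<inter> prio n m v \<delta>. \<exists>k'\<in>bags s. val m v i' (Bbag n m k') \<ge> 3/4 + \<delta>)
        \<longrightarrow> i \<in> prio n m v \<delta> \<rbrakk>
    \<Longrightarrow> step n m v \<delta> s ((give s i (Bbag n m k))\<lparr>bags := bags s - {k}\<rparr>)"
| p1_end: "\<lbrakk> phase s = 1;
      \<not> (\<exists>i\<in>agents s. \<exists>k\<in>bags s. val m v i (Bbag n m k) \<ge> 3/4 + \<delta>) \<rbrakk>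
    \<Longrightarrow> step n m v \<delta> s (s\<lparr>phase := 2\<rparr>)"
| p2_give: "\<lbrakk> phase s = 2; i \<in> agents s;
      val m v i (goodsAt (goods s) {1,2}) \<ge> 3/4 + \<delta>;
      (\<exists>i'\<in>agents s \<inter> prio n m v \<delta>. val m v i' (goodsAt (goods s) {1,2}) \<ge> 3/4 + \<delta>)
        \<longrightarrow> i \<in> prio n m v \<delta> \<rbrakk>
    \<Longrightarrow> step n m v \<delta> s (give s i (goodsAt (goods s) {1,2}))"
| p2_end: "\<lbrakk> phase s = 2;
      \<not> (\<exists>i\<in>agents s. val m v i (goodsAt (goods s) {1,2}) \<ge> 3/4 + \<delta>) \<rbrakk>
    \<Longrightarrow> step n m v \<delta> s (s\<lparr>phase := 3\<rparr>)"
| p3_R2: "\<lbrakk> phase s = 3; i \<in> agents s; n' = card (agents s);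
      val m v i (goodsAt (goods s) {2*n'-1, 2*n', 2*n'+1}) \<ge> 3/4 + \<delta> \<rbrakk>
    \<Longrightarrow> step n m v \<delta> s (give s i (goodsAt (goods s) {2*n'-1, 2*n', 2*n'+1}))"
| p3_R3: "\<lbrakk> phase s = 3; i \<in> agents s; n' = card (agents s);
      \<not> (\<exists>j\<in>agents s. val m v j (goodsAt (goods s) {2*n'-1, 2*n', 2*n'+1}) \<ge> 3/4 + \<delta>);
      val m v i (goodsAt (goods s) {3*n'-2, 3*n'-1, 3*n', 3*n'+1}) \<ge> 3/4 + \<delta> \<rbrakk>
    \<Longrightarrow> step n m v \<delta> s (give s i (goodsAt (goods s) {3*n'-2, 3*n'-1, 3*n', 3*n'+1}))"
| p3_end: "\<lbrakk> phase s = 3; n' = card (agents s);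
      \<not> (\<exists>j\<in>agents s. val m v j (goodsAt (goods s) {2*n'-1, 2*n', 2*n'+1}) \<ge> 3/4 + \<delta>);
      \<not> (\<exists>j\<in>agents s. val m v j (goodsAt (goods s) {3*n'-2, 3*n'-1, 3*n', 3*n'+1}) \<ge> 3/4 + \<delta>) \<rbrakk>
    \<Longrightarrow> step n m v \<delta> s (s\<lparr>phase := 4, np := n', cur := 1,
          cbags := (\<lambda>k. goodsAt (goods s) {k, 2*n'-k+1, 2*n'+k}),
          goods := goods s - goodsAt (goods s) {1..3*n'}\<rparr>)"
| p4_add: "\<lbrakk> phase s = 4; cur s \<le> np s;
      \<not> (\<exists>j\<in>agents s. val m v j (cbags s (cur s)) \<ge> 3/4 + \<delta>);
      g \<in> goods s \<rbrakk>
    \<Longrightarrow> step n m v \<delta> s (s\<lparr>cbags := (cbags s)(cur s := insert g (cbags s (cur s))),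
                          goods := goods s - {g}\<rparr>)"
| p4_give: "\<lbrakk> phase s = 4; cur s \<le> np s; i \<in> agents s;
      val m v i (cbags s (cur s)) \<ge> 3/4 + \<delta>;
      (\<exists>i'\<in>agents s \<inter> prio n m v \<delta>. val m v i' (cbags s (cur s)) \<ge> 3/4 + \<delta>)
        \<longrightarrow> i \<in> prio n m v \<delta> \<rbrakk>
    \<Longrightarrow> step n m v \<delta> s ((give s i (cbags s (cur s)))\<lparr>cur := cur s + 1\<rparr>)"
| p4_end: "\<lbrakk> phase s = 4; np s < cur s \<rbrakk>
    \<Longrightarrow> step n m v \<delta> s (s\<lparr>phase := 5\<rparr>)"

end

theory Submission
  imports Defs
begin

text \<open>
  Write \<open>\<alpha> = 3/4 + \<delta>\<close>. The run can only fail in phase 4, at a bag that nobody values at \<open>\<alpha>\<close> when no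
  goods are left; fix an agent i remaining at that point.

  If i has priority, then \<open>v\<^sub>i(2n+1) < 1/4 - 5\<delta>\<close>. Bags taken by other priority agents in phases 1 and 2
  cost i at most \<open>2\<alpha>\<close>, and there are few of them; bags taken by non-priority agents in these phases
  cost i less than \<open>\<alpha>\<close>; all later bags cost i at most \<open>1 - 4\<delta>\<close> in an amortised sense, the potential
  being the total excess over \<open>1/4 - 5\<delta>\<close> of the goods beyond position 2n'. The sum stays below n.

  If i is in \<open>N\<^sup>1\<^sub>1\<close>, every good is worth at most \<open>1/2 + 6\<delta>\<close> to i, so after phases 1 and 2 the remaining goods
  can be split into n' bundles of value at least \<open>1 - 12\<delta>\<close>, and the rules of phase 3 preserve this. If
  only \<open>C\<^sub>1\<close> can exceed \<open>1 - 12\<delta>\<close>, comparing total values gives a contradiction. Otherwise some other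
  \<open>C\<^sub>k\<close> exceeds \<open>1 - 12\<delta>\<close>, which forces the leading goods to be worth about 3/8; then rounding values
  to weights in multiples of 1/8 gives every bundle of the split weight at least 1, every bag weight
  at most 1 and the failing bag weight less than 1.
\<close>

section \<open>Positions\<close>

definition pos :: "nat set \<Rightarrow> nat \<Rightarrow> nat" where
  "pos G p = sorted_list_of_set G ! (p - 1)"

definition pval :: "(nat \<Rightarrow> real) \<Rightarrow> nat set \<Rightarrow> nat \<Rightarrow> real" where
  "pval u G p = (if 1 \<le> p \<and> p \<le> card G then u (pos G p) else 0)"

text \<open>Original indices list the goods by decreasing value for every agent, so sorting
  \<open>G\<close> by index is the re-indexing of the algorithm. Together with the value 0 past
  \<open>card G\<close> this makes \<open>pval u G\<close> decreasing from position 1 on, dummy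
  goods included.\<close>

definition decr :: "(nat \<Rightarrow> real) \<Rightarrow> nat set \<Rightarrow> bool" where
  "decr u G \<longleftrightarrow> finite G \<and> (\<forall>g\<in>G. 0 \<le> u g) \<and> (\<forall>g\<in>G. \<forall>h\<in>G. g \<le> h \<longrightarrow> u h \<le> u g)"

lemma pos_strict_mono:
  assumes "1 \<le> p" "p < q" "q \<le> card G"
  shows "pos G p < pos G q"
  unfolding pos_def using assms
  by (intro sorted_wrt_nth_less[OF strict_sorted_list_of_set]) auto

lemma pos_mem: "1 \<le> p \<Longrightarrow> p \<le> card G \<Longrightarrow> pos G p \<in> G"
proof -
  assume a: "1 \<le> p" "p \<le> card G"
  then have "finite G" using card.infinite by fastforce
  then show ?thesis unfolding pos_def using a
    by (metis One_nat_def Suc_le_eq Suc_pred length_sorted_list_of_set nth_mem set_sorted_list_of_set Suc_pred' le_trans less_le_trans)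
qed

lemma pos_inj: "inj_on (pos G) {1..card G}"
  by (rule linorder_inj_onI) (auto simp: pos_strict_mono less_imp_neq)

lemma pos_image: "finite G \<Longrightarrow> pos G ` {1..card G} = G"
proof (rule card_subset_eq)
  show "pos G ` {1..card G} \<subseteq> G" by (auto simp: pos_mem)
  show "card (pos G ` {1..card G}) = card G" using card_image[OF pos_inj[of G]] by simp
qed

lemma pos_cases:
  assumes "finite G" "g \<in> G"
  obtains q where "g = pos G q" "q \<in> {1..card G}"
  using assms pos_image[OF assms(1)] by blast

lemma goodsAt_pos: "goodsAt G J = pos G ` (J \<inter> {1..card G})"
  unfolding goodsAt_def pos_def by auto

lemma goodsAt_subset: "goodsAt G J \<subseteq> G"
  unfolding goodsAt_pos by (auto simp: pos_mem)

lemma goodsAt_mono: "J \<subseteq> K \<Longrightarrow> goodsAt G J \<subseteq> goodsAt G K"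
  unfolding goodsAt_pos by auto

lemma goodsAt_Un: "goodsAt G (J \<union> K) = goodsAt G J \<union> goodsAt G K"
  unfolding goodsAt_pos by auto

lemma goodsAt_disjoint: "J \<inter> K = {} \<Longrightarrow> goodsAt G J \<inter> goodsAt G K = {}"
  unfolding goodsAt_pos using inj_on_image_Int[OF pos_inj[of G], of "J \<inter> {1..card G}" "K \<inter> {1..card G}"]
  by auto

lemma card_goodsAt: "card (goodsAt G J) = card (J \<inter> {1..card G})"
  unfolding goodsAt_pos by (rule card_image) (meson inf_le2 inj_on_subset pos_inj)

lemma pos_le_iff: "p \<in> {1..card G} \<Longrightarrow> q \<in> {1..card G} \<Longrightarrow> pos G p \<le> pos G q \<longleftrightarrow> p \<le> q"
  by (metis atLeastAtMost_iff leD leI le_eq_less_or_eq pos_strict_mono)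

text \<open>Since \<open>\<phi>\<close> vanishes at 0, dummy positions contribute nothing, and later
  sums run over fixed sets of positions without a case split on \<open>card G\<close>. The general
  \<open>\<phi>\<close> serves the identity, the truncations at y and the weight
  \<open>wt\<close>.\<close>

lemma sum_goodsAt:
  assumes "finite J" "0 \<notin> J" "\<phi> 0 = (0::real)"
  shows "(\<Sum>g\<in>goodsAt G J. \<phi> (u g)) = (\<Sum>p\<in>J. \<phi> (pval u G p))"
proof -
  have "(\<Sum>g\<in>goodsAt G J. \<phi> (u g)) = (\<Sum>p\<in>J \<inter> {1..card G}. \<phi> (u (pos G p)))"
    unfolding goodsAt_pos by (rule sum.reindex_cong[of "pos G"]) (auto intro: inj_on_subset[OF pos_inj])
  also have "\<dots> = (\<Sum>p\<in>J. \<phi> (pval u G p))"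
    by (rule sum.mono_neutral_cong_left) (use assms in \<open>auto simp: pval_def Suc_le_eq\<close>)
  finally show ?thesis .
qed

lemma pval_nonneg: "decr u G \<Longrightarrow> 0 \<le> pval u G p"
  unfolding decr_def pval_def by (auto simp: pos_mem)

lemma pval_antimono:
  assumes "decr u G" "1 \<le> p" "p \<le> q"
  shows "pval u G q \<le> pval u G p"
proof (cases "q \<le> card G")
  case True
  then have "pos G p \<le> pos G q" using assms pos_le_iff[of p G q] by auto
  then show ?thesis using True assms by (auto simp: pval_def decr_def pos_mem)
next
  case False
  then show ?thesis using pval_nonneg[OF assms(1)] by (simp add: pval_def)
qed

lemma goodsAt_initial_less:
  assumes "finite G" "a \<in> goodsAt G {1..t}" "g \<in> G - goodsAt G {1..t}"
  shows "a < g"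
proof -
  obtain q where q: "g = pos G q" "q \<in> {1..card G}" using assms pos_cases[OF assms(1)] by blast
  obtain p where p: "a = pos G p" "p \<in> {1..t} \<inter> {1..card G}" using assms unfolding goodsAt_pos by auto
  have "q \<notin> {1..t}" using q assms unfolding goodsAt_pos by auto
  then show ?thesis using p q by (auto intro: pos_strict_mono)
qed

text \<open>Both sets are initial segments of \<open>G\<close> of the same size. If they differed,
  each would have an element outside the other, and these two elements would each have to precede
  the other.\<close>

lemma goodsAt_initial_eq:
  assumes "finite G" "A \<subseteq> G" "\<And>a g. a \<in> A \<Longrightarrow> g \<in> G - A \<Longrightarrow> a < g" "card A = min t (card G)"
  shows "goodsAt G {1..t} = A"
proof -
  let ?B = "goodsAt G {1..t}"
  have cB: "card ?B = card A"
    unfolding card_goodsAt assms(4) by (simp add: min_def)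
  have BG: "?B \<subseteq> G" by (rule goodsAt_subset)
  have fin: "finite A" "finite ?B" using assms(1,2) BG finite_subset by auto
  have "?B \<subseteq> A"
  proof (rule ccontr)
    assume n: "\<not> ?B \<subseteq> A"
    then obtain b where b: "b \<in> ?B" "b \<notin> A" by auto
    have "\<not> A \<subseteq> ?B" using card_subset_eq[OF fin(2), of A] cB n by auto
    then obtain a where a: "a \<in> A" "a \<notin> ?B" by auto
    have "a < b" using assms(3)[of a b] a b BG by auto
    moreover have "b < a" using goodsAt_initial_less[OF assms(1), of b t a] a b assms(2) by auto
    ultimately show False by simp
  qed
  then show ?thesis using card_subset_eq[OF fin(1)] cB by auto
qed

lemma goodsAt_diff_initial:
  assumes "finite G" "R \<subseteq> G" "R \<inter> goodsAt G {1..t} = {}"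
  shows "goodsAt (G - R) {1..t} = goodsAt G {1..t}"
proof (rule goodsAt_initial_eq)
  have sub: "goodsAt G {1..t} \<subseteq> G - R" using assms goodsAt_subset by blast
  show "finite (G - R)" "goodsAt G {1..t} \<subseteq> G - R" using assms sub by auto
  show "a < g" if "a \<in> goodsAt G {1..t}" "g \<in> G - R - goodsAt G {1..t}" for a g
    using goodsAt_initial_less[OF assms(1)] that by auto
  have c: "card (goodsAt G {1..t}) = min t (card G)"
    unfolding card_goodsAt by (simp add: min_def)
  show "card (goodsAt G {1..t}) = min t (card (G - R))"
  proof (cases "card G \<le> t")
    case True
    then have "goodsAt G {1..t} = G"
      using c card_subset_eq[OF assms(1) goodsAt_subset[of G "{1..t}"]] by simp
    then have "R = {}" using assms by auto
    then show ?thesis using c by simp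
  next
    case False
    then show ?thesis using c card_mono[OF _ sub] assms(1) by simp
  qed
qed

text \<open>The extreme case p = t + 1 matters: with t = 3N it bounds an added good by the last of
  the four goods in the rule R3.\<close>

lemma pval_beyond:
  assumes "decr u G" "g \<in> G" "g \<notin> goodsAt G {1..t}" "1 \<le> p" "p \<le> Suc t"
  shows "u g \<le> pval u G p"
proof -
  have fin: "finite G" using assms(1) by (simp add: decr_def)
  obtain q where q: "g = pos G q" "q \<in> {1..card G}" using pos_cases[OF fin assms(2)] by blast
  have "q \<notin> {1..t}" using q assms(3) unfolding goodsAt_pos by auto
  then have "p \<le> q" using q assms by auto
  then have "pval u G q \<le> pval u G p" using pval_antimono assms by auto
  then show ?thesis using q by (simp add: pval_def)
qed

text \<open>Deleting goods only moves later goods forward. If position p of \<open>H\<close> came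
  before position p of \<open>G\<close>, the first p goods of \<open>H\<close> would lie among the
  first p - 1 goods of \<open>G\<close>.\<close>

lemma pval_subset_le:
  assumes "decr u G" "H \<subseteq> G"
  shows "pval u H p \<le> pval u G p"
proof (cases "1 \<le> p \<and> p \<le> card H")
  case True
  have fin: "finite G" "finite H" using assms finite_subset unfolding decr_def by auto
  have cH: "p \<le> card G" using True card_mono[OF fin(1) assms(2)] by simp
  have "pos G p \<le> pos H p"
  proof (rule ccontr)
    assume a: "\<not> pos G p \<le> pos H p"
    have sub: "pos H ` {1..p} \<subseteq> pos G ` {1..<p}"
    proof
      fix x assume "x \<in> pos H ` {1..p}"
      then obtain r where r: "x = pos H r" "1 \<le> r" "r \<le> p" by auto
      then have x: "x \<le> pos H p" using True pos_le_iff[of r H p] by auto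
      have "x \<in> G" using r True pos_mem[of r H] assms by auto
      then obtain q where q: "x = pos G q" "q \<in> {1..card G}" using pos_cases[OF fin(1)] by blast
      have "\<not> p \<le> q" using pos_le_iff[of p G q] q x a cH True by auto
      then show "x \<in> pos G ` {1..<p}" using q by auto
    qed
    have "card (pos H ` {1..p}) = p"
      using card_image[OF inj_on_subset[OF pos_inj[of H], of "{1..p}"]] True by auto
    moreover have "card (pos G ` {1..<p}) \<le> p - 1"
      using card_image_le[of "{1..<p}" "pos G"] by simp
    moreover have "card (pos H ` {1..p}) \<le> card (pos G ` {1..<p})"
      by (rule card_mono[OF _ sub]) simp
    ultimately show False using True by linarith
  qed
  moreover have "pos H p \<in> G" "pos G p \<in> G" using pos_mem True cH assms(2) by blast+
  ultimately have "u (pos H p) \<le> u (pos G p)" using assms(1) by (simp add: decr_def)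
  then show ?thesis using True cH by (simp add: pval_def)
next
  case False
  then have "pval u H p = 0" by (auto simp: pval_def)
  then show ?thesis using pval_nonneg[OF assms(1)] by simp
qed

section \<open>Bundles of guaranteed value\<close>

text \<open>The bundles need not exhaust G: goods sent outside K are discarded.\<close>

definition covers :: "(nat \<Rightarrow> real) \<Rightarrow> nat \<Rightarrow> nat set \<Rightarrow> real \<Rightarrow> bool" where
  "covers u d G t \<longleftrightarrow> (\<exists>(f :: nat \<Rightarrow> nat) K. finite K \<and> card K = d \<and>
     (\<forall>k\<in>K. t \<le> (\<Sum>g\<in>{g\<in>G. f g = k}. u g)))"

lemma covers_mono:
  fixes f :: "nat \<Rightarrow> nat"
  assumes "finite K" "d \<le> card K" "\<And>k. k \<in> K \<Longrightarrow> t \<le> (\<Sum>g\<in>{g\<in>G. f g = k}. u g)"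
  shows "covers u d G t"
proof -
  obtain K' where "K' \<subseteq> K" "card K' = d" "finite K'" using obtain_subset_with_card_n[OF assms(2)] by blast
  then show ?thesis unfolding covers_def using assms(3) by (intro exI[of _ f] exI[of _ K']) auto
qed

text \<open>The bundles are disjoint and each weighs at least 1, and goods outside them weigh
  nothing negative. It is applied to the scaled value and to \<open>wt\<close>.\<close>

lemma covers_sum_ge:
  assumes "covers u d G t" "finite G" "\<And>g. g \<in> G \<Longrightarrow> 0 \<le> u g"
    and "\<And>S. S \<subseteq> G \<Longrightarrow> t \<le> (\<Sum>g\<in>S. u g) \<Longrightarrow> (1::real) \<le> (\<Sum>g\<in>S. w g)"
    and "\<And>g. g \<in> G \<Longrightarrow> 0 \<le> w g"
  shows "real d \<le> (\<Sum>g\<in>G. w g)"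
proof -
  obtain f :: "nat \<Rightarrow> nat" and K where K: "finite K" "card K = d"
    "\<forall>k\<in>K. t \<le> (\<Sum>g\<in>{g\<in>G. f g = k}. u g)"
    using assms(1) unfolding covers_def by blast
  have "real d = (\<Sum>k\<in>K. 1)" using K by simp
  also have "\<dots> \<le> (\<Sum>k\<in>K. \<Sum>g\<in>{g\<in>G. f g = k}. w g)"
    by (rule sum_mono) (use K assms(4) in auto)
  also have "\<dots> = (\<Sum>k\<in>K. \<Sum>g\<in>{g\<in>{g\<in>G. f g \<in> K}. f g = k}. w g)"
    by (intro sum.cong refl) auto
  also have "\<dots> = (\<Sum>g\<in>{g\<in>G. f g \<in> K}. w g)"
    by (rule sum.group) (use K assms(2) in auto)
  also have "\<dots> \<le> (\<Sum>g\<in>G. w g)"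
    by (rule sum_mono2) (use assms in auto)
  finally show ?thesis .
qed

text \<open>Some bundle contains a set T of |R| goods of A; giving up that bundle, the other bundles can
  exchange their goods in R for the at least as valuable goods of T outside R.\<close>

lemma covers_reduction:
  assumes cov: "covers u d G t" and fin: "finite G" and nn: "\<And>g. g \<in> G \<Longrightarrow> 0 \<le> u g"
    and RA: "R \<subseteq> A" "A \<subseteq> G"
    and top: "\<And>a r. a \<in> A - R \<Longrightarrow> r \<in> R \<Longrightarrow> u r \<le> u a"
    and pig: "R \<noteq> {} \<Longrightarrow> (card R - 1) * d < card A" and d: "0 < d"
  shows "covers u (d - 1) (G - R) t"
proof -
  obtain f0 :: "nat \<Rightarrow> nat" and K where K: "finite K" "card K = d"
    and f0: "\<forall>k\<in>K. t \<le> (\<Sum>g\<in>{g\<in>G. f0 g = k}. u g)"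
    using cov unfolding covers_def by blast
  obtain k0 where k0: "k0 \<in> K" using K d by fastforce
  \<comment> \<open>Goods of discarded colours go to \<open>k0\<close>. Bundles only grow, and all
    of \<open>G\<close> is now coloured with d colours, as the pigeonhole count needs.\<close>
  define f where "f g = (if f0 g \<in> K then f0 g else k0)" for g
  have fK: "f g \<in> K" for g using k0 by (simp add: f_def)
  have f: "t \<le> (\<Sum>g\<in>{g\<in>G. f g = k}. u g)" if "k \<in> K" for k
  proof -
    have "(\<Sum>g\<in>{g\<in>G. f0 g = k}. u g) \<le> (\<Sum>g\<in>{g\<in>G. f g = k}. u g)"
      by (rule sum_mono2) (use fin nn that in \<open>auto simp: f_def\<close>)
    then show ?thesis using f0 that by fastforce
  qed
  have finA: "finite A" using RA fin by (auto intro: finite_subset)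
  have finR: "finite R" using RA finA by (auto intro: finite_subset)
  obtain b where b: "b \<in> K" "card R \<le> card {g\<in>A. f g = b}"
  \<comment> \<open>Without removed goods the hypothesis \<open>pig\<close> says nothing, but then
    any bundle may be given up.\<close>
  proof (cases "R = {}")
    case True
    then show ?thesis using that k0 by simp
  next
    case False
    have "\<exists>b\<in>K. card R \<le> card {g\<in>A. f g = b}"
    proof (rule ccontr)
      assume "\<not> ?thesis"
      then have lt: "card {g\<in>A. f g = b} \<le> card R - 1" if "b \<in> K" for b using that by fastforce
      have "card A = (\<Sum>b\<in>K. card {g\<in>A. f g = b})"
        using sum.group[of A K f "\<lambda>_. 1::nat"] finA K fK by (auto simp: image_subset_iff)
      also have "\<dots> \<le> (\<Sum>b\<in>K. card R - 1)" by (rule sum_mono) (rule lt)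
      finally show False using pig[OF False] K by (simp add: mult.commute)
    qed
    then show ?thesis using that by blast
  qed
  obtain T where T: "T \<subseteq> {g\<in>A. f g = b}" "card T = card R" "finite T"
    using obtain_subset_with_card_n[OF b(2)] by blast
  have "card (T - R) = card (R - T)"
    using T(2,3) finR by (simp add: card_Diff_subset_Int Int_commute)
  then obtain h where h: "bij_betw h (T - R) (R - T)"
    using finite_same_card_bij[of "T - R" "R - T"] T(3) finR by auto
  \<comment> \<open>Each good of T outside R inherits the colour of its partner in R, which
    disappears; by \<open>top\<close> it is worth at least as much.\<close>
  define f' where "f' g = (if g \<in> T - R then f (h g) else f g)" for g
  have "t \<le> (\<Sum>g\<in>{g\<in>G - R. f' g = k}. u g)" if k: "k \<in> K - {b}" for k
  proof -
    let ?P = "{g\<in>G. f g = k}"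
    let ?X = "{g\<in>T - R. f (h g) = k}"
    have hX: "h ` ?X = ?P \<inter> R"
    proof
      show "h ` ?X \<subseteq> ?P \<inter> R" using h RA unfolding bij_betw_def by auto
      show "?P \<inter> R \<subseteq> h ` ?X"
      proof
        fix r assume r: "r \<in> ?P \<inter> R"
        then have "r \<in> R - T" using T k by auto
        then have "r \<in> h ` (T - R)" using h unfolding bij_betw_def by auto
        then show "r \<in> h ` ?X" using r by auto
      qed
    qed
    have inj: "inj_on h ?X" using h unfolding bij_betw_def by (auto intro: inj_on_subset)
    have "t \<le> (\<Sum>g\<in>?P. u g)" using f k by auto
    also have "\<dots> = (\<Sum>g\<in>?P - R. u g) + (\<Sum>g\<in>?P \<inter> R. u g)"
      by (subst add.commute, rule sum.Int_Diff) (use fin in auto)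
    also have "(\<Sum>g\<in>?P \<inter> R. u g) = (\<Sum>g\<in>?X. u (h g))"
      unfolding hX[symmetric] sum.reindex[OF inj] by (simp only: o_def)
    also have "\<dots> \<le> (\<Sum>g\<in>?X. u g)"
    proof (rule sum_mono)
      fix g assume "g \<in> ?X"
      moreover from this have "h g \<in> R" using h unfolding bij_betw_def by auto
      ultimately show "u (h g) \<le> u g" using top T by auto
    qed
    also have "(\<Sum>g\<in>?P - R. u g) + (\<Sum>g\<in>?X. u g) = (\<Sum>g\<in>(?P - R) \<union> ?X. u g)"
      by (rule sum.union_disjoint[symmetric]) (use fin T k in auto)
    also have "(?P - R) \<union> ?X = {g\<in>G - R. f' g = k}"
      using T RA k unfolding f'_def by auto
    finally show ?thesis by simp
  qed
  then show ?thesis using covers_mono[where K = "K - {b}" and f = f'] K b by simp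
qed

text \<open>Bundles missing two or more goods are discarded; those missing a single good are
  merged in pairs.\<close>

lemma covers_after_removal:
  fixes f :: "nat \<Rightarrow> nat"
  assumes K: "finite K" "card K = d" and fin: "finite G" and nn: "\<And>g. g \<in> G \<Longrightarrow> 0 \<le> u g"
    and one: "\<And>k. k \<in> K \<Longrightarrow> (\<Sum>g\<in>{g\<in>G. f g = k}. u g) \<ge> 1"
    and R: "R \<subseteq> G" "card R \<le> 2 * r" and small: "\<And>g. g \<in> R \<Longrightarrow> u g \<le> 1/2 + e" and e: "0 \<le> e"
  shows "covers u (d - r) (G - R) (1 - 2 * e)"
proof -
  define c where "c k = card {g\<in>R. f g = k}" for k
  define E0 where "E0 = {k\<in>K. c k = 0}"
  define E1 where "E1 = {k\<in>K. c k = 1}"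
  define E2 where "E2 = {k\<in>K. c k \<ge> 2}"
  have finR: "finite R" using R fin finite_subset by blast
  have finE: "finite E0" "finite E1" "finite E2" using K by (auto simp: E0_def E1_def E2_def)
  have "K = E0 \<union> E1 \<union> E2" by (auto simp: E0_def E1_def E2_def)
  then have cK: "card K = card E0 + card E1 + card E2"
  proof -
    have "(E0 \<union> E1) \<inter> E2 = {}" "E0 \<inter> E1 = {}" by (auto simp: E0_def E1_def E2_def)
    then show ?thesis using finE \<open>K = E0 \<union> E1 \<union> E2\<close> by (simp add: card_Un_disjoint)
  qed
  have "card E1 + 2 * card E2 \<le> (\<Sum>k\<in>E1. c k) + (\<Sum>k\<in>E2. c k)"
    using sum_bounded_below[of E2 2 c] by (auto simp: E1_def E2_def)
  also have "\<dots> = (\<Sum>k\<in>E1 \<union> E2. c k)"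
    by (rule sum.union_disjoint[symmetric]) (use finE in \<open>auto simp: E1_def E2_def\<close>)
  also have "\<dots> = (\<Sum>k\<in>E1 \<union> E2. card {g\<in>{g\<in>R. f g \<in> E1 \<union> E2}. f g = k})"
    unfolding c_def by (intro sum.cong refl arg_cong[of _ _ card]) auto
  also have "\<dots> = card {g\<in>R. f g \<in> E1 \<union> E2}"
    using sum.group[of "{g\<in>R. f g \<in> E1 \<union> E2}" "E1 \<union> E2" f "\<lambda>_. 1::nat"] finR finE by auto
  also have "\<dots> \<le> card R" by (rule card_mono) (use finR in auto)
  finally have cnt: "card E1 + 2 * card E2 \<le> 2 * r" using R by simp
  have "card E1 div 2 \<le> card E1" by simp
  then obtain H where H: "H \<subseteq> E1" "card H = card E1 div 2" "finite H"
    using obtain_subset_with_card_n by blast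
  have "card E1 div 2 \<le> card (E1 - H)" using H finE by (simp add: card_Diff_subset)
  then obtain H' where H': "H' \<subseteq> E1 - H" "card H' = card E1 div 2" "finite H'"
    using obtain_subset_with_card_n by blast
  obtain h where h: "bij_betw h H H'" using finite_same_card_bij[OF H(3) H'(3)] H H' by auto
  define f' where "f' g = (if f g \<in> H' then inv_into H h (f g) else f g)" for g
  \<comment> \<open>A bundle missing one good keeps 1 - (1/2 + e), so a merged pair has 1 -
    2e.\<close>
  have rest: "(\<Sum>g\<in>{g\<in>G - R. f g = k}. u g) \<ge> 1/2 - e" if k: "k \<in> E1" for k
  proof -
    have "card {g\<in>R. f g = k} = 1" using k by (simp add: E1_def c_def)
    then obtain r where r: "{g\<in>R. f g = k} = {r}" using card_1_singletonE by blast
    have rr: "r \<in> R" "f r = k" using r by auto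
    have eq: "{g\<in>G. f g = k} = insert r {g\<in>G - R. f g = k}" using r R by auto
    have "(\<Sum>g\<in>{g\<in>G. f g = k}. u g) = u r + (\<Sum>g\<in>{g\<in>G - R. f g = k}. u g)"
      unfolding eq by (rule sum.insert) (use fin rr in auto)
    moreover have "(\<Sum>g\<in>{g\<in>G. f g = k}. u g) \<ge> 1" using one k by (auto simp: E1_def)
    moreover have "u r \<le> 1/2 + e" using small rr by auto
    ultimately show ?thesis by simp
  qed
  have "1 - 2 * e \<le> (\<Sum>g\<in>{g\<in>G - R. f' g = k}. u g)" if k: "k \<in> E0 \<union> H" for k
  proof (cases "k \<in> H")
    case True
    have hk: "h k \<in> H'" using h True unfolding bij_betw_def by auto
    have inv: "inv_into H h (h k) = k" using h True unfolding bij_betw_def by auto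
    have kn: "k \<notin> H'" using H' True by auto
    have "f' g = k \<longleftrightarrow> f g = k \<or> f g = h k" for g
    proof (cases "f g \<in> H'")
      case T: True
      then have "h (inv_into H h (f g)) = f g" using h unfolding bij_betw_def by (auto intro: f_inv_into_f)
      then show ?thesis using T kn inv unfolding f'_def by auto
    next
      case False
      then show ?thesis using hk unfolding f'_def by auto
    qed
    then have "{g\<in>G - R. f' g = k} = {g\<in>G - R. f g = k} \<union> {g\<in>G - R. f g = h k}" by auto
    moreover have "(\<Sum>g\<in>{g\<in>G - R. f g = k} \<union> {g\<in>G - R. f g = h k}. u g) =
       (\<Sum>g\<in>{g\<in>G - R. f g = k}. u g) + (\<Sum>g\<in>{g\<in>G - R. f g = h k}. u g)"
      by (rule sum.union_disjoint) (use fin kn hk in auto)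
    moreover have "k \<in> E1" "h k \<in> E1" using True H H' hk by auto
    ultimately show ?thesis using rest[of k] rest[of "h k"] by simp
  next
    case False
    then have k0: "k \<in> E0" using k by auto
    have "finite {g\<in>R. f g = k}" using finR by auto
    then have noR: "{g\<in>R. f g = k} = {}" using k0 by (auto simp: E0_def c_def)
    have knH: "k \<notin> H'" using k0 H' by (auto simp: E0_def E1_def)
    have "f' g = k \<longleftrightarrow> f g = k" for g
    proof (cases "f g \<in> H'")
      case T: True
      then have "inv_into H h (f g) \<in> H" using h unfolding bij_betw_def by (auto intro: inv_into_into)
      then show ?thesis using T knH False unfolding f'_def by auto
    next
      case False
      then show ?thesis unfolding f'_def by auto
    qed
    then have "{g\<in>G - R. f' g = k} = {g\<in>G. f g = k}" using noR by auto
    then show ?thesis using one[of k] k0 e by (auto simp: E0_def)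
  qed
  moreover have "card (E0 \<union> H) = card E0 + card H"
    by (rule card_Un_disjoint) (use finE H in \<open>auto simp: E0_def E1_def\<close>)
  \<comment> \<open>Lost are all of \<open>E2\<close> and, rounding up, half of \<open>E1\<close>.
    From \<open>cnt\<close> this is at most r; an unpaired bundle of an odd \<open>E1\<close> is
    covered because the right side 2r is even.\<close>
  then have "d - r \<le> card (E0 \<union> H)" using cK cnt K H by linarith
  ultimately show ?thesis using covers_mono[where K = "E0 \<union> H" and f = f'] finE H by simp
qed

text \<open>Among the top jd + 1 goods, d bundles must have j + 1 goods in common with one of them.
  The cases j = 2 and j = 3 are the bundles of R2 and R3.\<close>

lemma covers_goodsAt_reduction:
  assumes cov: "covers u d G t" and dec: "decr u G" and d: "0 < d"
  shows "covers u (d - 1) (G - goodsAt G {j * (d - 1) + 1..j * d + 1}) t"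
proof -
  have fin: "finite G" using dec by (simp add: decr_def)
  let ?A = "goodsAt G {1..j * d + 1}" and ?R = "goodsAt G {j * (d - 1) + 1..j * d + 1}"
  let ?L = "min (j * d + 1) (card G)"
  have "{1..j * d + 1} \<inter> {1..card G} = {1..?L}" by auto
  then have cA: "card ?A = ?L" unfolding card_goodsAt by simp
  have "{j * (d - 1) + 1..j * d + 1} \<inter> {1..card G} = {j * (d - 1) + 1..?L}" by auto
  then have cR: "card ?R = ?L - j * (d - 1)" unfolding card_goodsAt by simp
  show ?thesis
  proof (rule covers_reduction[OF cov fin])
    show "0 \<le> u g" if "g \<in> G" for g using dec that by (simp add: decr_def)
    show "?R \<subseteq> ?A" by (rule goodsAt_mono) auto
    show "?A \<subseteq> G" by (rule goodsAt_subset)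
    show "0 < d" by (rule d)
    show "u r \<le> u a" if ar: "a \<in> ?A - ?R" "r \<in> ?R" for a r
    proof -
      have "a \<in> goodsAt G {1..j * (d - 1)}"
      proof -
        have "{1..j * d + 1} \<subseteq> {1..j * (d - 1)} \<union> {j * (d - 1) + 1..j * d + 1}" by auto
        then have "?A \<subseteq> goodsAt G {1..j * (d - 1)} \<union> ?R" using goodsAt_mono goodsAt_Un by metis
        then show ?thesis using ar by auto
      qed
      moreover have "goodsAt G {1..j * (d - 1)} \<inter> ?R = {}" by (rule goodsAt_disjoint) auto
      moreover have "r \<in> G" "a \<in> G" using ar goodsAt_subset by blast+
      ultimately have "a < r" using goodsAt_initial_less[OF fin, of a "j * (d - 1)" r] ar by auto
      then show ?thesis using dec \<open>r \<in> G\<close> \<open>a \<in> G\<close> by (simp add: decr_def)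
    qed
    \<comment> \<open>With fewer than jd + 1 real goods, R has only r + 1 goods for some r \<le> j;
      then A has j(d - 1) + r + 1 > rd goods, so the pigeonhole still works.\<close>
    show "(card ?R - 1) * d < card ?A" if "?R \<noteq> {}"
    proof -
      have "finite ?R" by (rule finite_subset[OF goodsAt_subset fin])
      then have pos: "0 < card ?R" using that by (simp add: card_gt_0_iff)
      define r where "r = card ?R - 1"
      have L: "?L = j * (d - 1) + r + 1" using pos cR unfolding r_def by linarith
      have "j * d = j * (d - 1) + j" using d by (cases d) auto
      then have rj: "r \<le> j" using L by linarith
      have "r * d = r * (d - 1) + r" using d by (cases d) auto
      also have "\<dots> \<le> j * (d - 1) + r" using rj by simp
      finally show ?thesis using L cA unfolding r_def by simp
    qed
  qed
qed

section \<open>Bag filling\<close>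

text \<open>The weight is constant on intervals of length \<open>40\<delta>/3\<close> ending at the thresholds
  \<open>(j/8)(1 + 4\<delta>/3)\<close>, j = 2, 3 (the first interval is longer), and has slope \<open>slope \<delta>\<close> elsewhere. The slope
  is chosen such that 7/8 of weight in thresholds plus the missing value
  \<open>1 - 12\<delta> - (7/8)(1 + 4\<delta>/3)\<close> yields weight exactly 1.\<close>

definition slope :: "real \<Rightarrow> real" where
  "slope \<delta> = 1 / (1 - 316 * \<delta> / 3)"

definition wt :: "real \<Rightarrow> real \<Rightarrow> real" where
  "wt \<delta> x =
     (if x \<le> 1/4 + \<delta>/3 then min (slope \<delta> * x) (1/4)
      else if x \<le> 3/8 + \<delta>/2 then min (1/4 + slope \<delta> * (x - 1/4 - \<delta>/3)) (3/8)
      else 3/8 + slope \<delta> * (x - 3/8 - \<delta>/2))"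

context
  fixes \<delta> :: real
  assumes \<delta>: "0 \<le> \<delta>" "\<delta> \<le> 3/956"
begin

lemma slope_pos: "0 < slope \<delta>"
  using \<delta> by (simp add: slope_def)

lemma slope_mult: "slope \<delta> * (1 - 316 * \<delta> / 3) = 1"
  using \<delta> by (simp add: slope_def)

text \<open>Equality holds at \<delta> = 3/956. Every later weight estimate for an excess
  proportional to \<delta> goes through this constant.\<close>

lemma slope_bound: "slope \<delta> * \<delta> \<le> 3/640"
proof -
  have "slope \<delta> * \<delta> = \<delta> / (1 - 316 * \<delta> / 3)" by (simp add: slope_def)
  also have "\<dots> \<le> 3/640"
    using \<delta> by (subst pos_divide_le_eq) auto
  finally show ?thesis .
qed

lemma wt_nonneg: "0 \<le> x \<Longrightarrow> 0 \<le> wt \<delta> x"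
  using slope_pos \<delta> by (auto simp: wt_def intro!: add_nonneg_nonneg)

lemma wt_zero: "wt \<delta> 0 = 0"
  using \<delta> by (simp add: wt_def)

lemma wt_le_slope: "x \<le> 1/4 + \<delta>/3 \<Longrightarrow> wt \<delta> x \<le> slope \<delta> * x"
  by (simp add: wt_def)

lemma wt_le_quarter: "x \<le> 1/4 + \<delta>/3 \<Longrightarrow> wt \<delta> x \<le> 1/4"
  by (simp add: wt_def)

lemma wt_le_three_eighths: "x \<le> 3/8 + \<delta>/2 \<Longrightarrow> wt \<delta> x \<le> 3/8"
  using \<delta> by (auto simp: wt_def min_def)

text \<open>On a flat piece the value is below the threshold at its end, so e = 0 suffices; on a
  sloped piece e is the distance from the previous threshold. Only j = 0, 2, 3 occur.\<close>

lemma wt_decomp: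
  assumes "0 \<le> x"
  shows "\<exists>(j::nat) e. 0 \<le> e \<and> x \<le> real j / 8 * (1 + 4 * \<delta> / 3) + e \<and> wt \<delta> x = real j / 8 + slope \<delta> * e"
proof -
  consider "x \<le> 1/4 + \<delta>/3" "slope \<delta> * x \<le> 1/4" | "x \<le> 1/4 + \<delta>/3" "slope \<delta> * x > 1/4"
    | "x > 1/4 + \<delta>/3" "x \<le> 3/8 + \<delta>/2" "1/4 + slope \<delta> * (x - 1/4 - \<delta>/3) \<le> 3/8"
    | "x > 1/4 + \<delta>/3" "x \<le> 3/8 + \<delta>/2" "1/4 + slope \<delta> * (x - 1/4 - \<delta>/3) > 3/8"
    | "x > 3/8 + \<delta>/2" by linarith
  then show ?thesis
  proof cases
    case 1 then show ?thesis using assms by (intro exI[of _ "0::nat"] exI[of _ x]) (auto simp: wt_def)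
  next
    case 2 then show ?thesis by (intro exI[of _ "2::nat"] exI[of _ "0::real"]) (auto simp: wt_def)
  next
    case 3 then show ?thesis by (intro exI[of _ "2::nat"] exI[of _ "x - 1/4 - \<delta>/3"]) (auto simp: wt_def add_divide_distrib)
  next
    case 4 then show ?thesis by (intro exI[of _ "3::nat"] exI[of _ "0::real"]) (auto simp: wt_def)
  next
    case 5 then show ?thesis using \<delta> by (intro exI[of _ "3::nat"] exI[of _ "x - 3/8 - \<delta>/2"]) (auto simp: wt_def algebra_simps)
  qed
qed

lemma wt_sum_ge_one:
  assumes "finite S" "\<And>g. g \<in> S \<Longrightarrow> 0 \<le> u g" "1 - 12 * \<delta> \<le> (\<Sum>g\<in>S. u g)"
  shows "1 \<le> (\<Sum>g\<in>S. wt \<delta> (u g))"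
proof -
  have "\<forall>g\<in>S. \<exists>(j::nat) e. 0 \<le> e \<and> u g \<le> real j / 8 * (1 + 4 * \<delta> / 3) + e \<and> wt \<delta> (u g) = real j / 8 + slope \<delta> * e"
    using wt_decomp assms(2) by blast
  then obtain j :: "_ \<Rightarrow> nat" and e where je: "\<And>g. g \<in> S \<Longrightarrow> 0 \<le> e g"
    "\<And>g. g \<in> S \<Longrightarrow> u g \<le> real (j g) / 8 * (1 + 4 * \<delta> / 3) + e g"
    "\<And>g. g \<in> S \<Longrightarrow> wt \<delta> (u g) = real (j g) / 8 + slope \<delta> * e g" by metis
  define J where "J = (\<Sum>g\<in>S. j g)"
  define E where "E = (\<Sum>g\<in>S. e g)"
  have E0: "0 \<le> E" unfolding E_def using je by (simp add: sum_nonneg)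
  have W: "(\<Sum>g\<in>S. wt \<delta> (u g)) = real J / 8 + slope \<delta> * E"
    unfolding J_def E_def by (simp add: je sum.distrib sum_distrib_left sum_divide_distrib)
  have "(\<Sum>g\<in>S. u g) \<le> (\<Sum>g\<in>S. real (j g) / 8 * (1 + 4 * \<delta> / 3) + e g)"
    by (rule sum_mono) (rule je)
  also have "\<dots> = real J / 8 * (1 + 4 * \<delta> / 3) + E"
    unfolding J_def E_def by (simp add: sum.distrib sum_distrib_right sum_divide_distrib)
  finally have V: "1 - 12 * \<delta> - real J / 8 * (1 + 4 * \<delta> / 3) \<le> E" using assms(3) by simp
  show ?thesis
  proof (cases "J \<ge> 8")
    case True
    moreover have "0 \<le> slope \<delta> * E" using E0 slope_pos by simp
    ultimately show ?thesis using W by simp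
  next
    case False
    then have J: "real J \<le> 7" by simp
    \<comment> \<open>For J \<le> 7 the remainder is nonnegative, and it vanishes exactly in the
      case J = 7 for which the slope was chosen (or \<delta> = 0).\<close>
    have "(1 - real J / 8) * (1 - 316 * \<delta> / 3) + \<delta> * (40/3 * (7 - real J)) = 1 - 12 * \<delta> - real J / 8 * (1 + 4 * \<delta> / 3)"
      by (simp add: field_simps)
    moreover have "0 \<le> \<delta> * (40/3 * (7 - real J))" using \<delta> J by simp
    ultimately have "(1 - real J / 8) * (1 - 316 * \<delta> / 3) \<le> E" using V by linarith
    then have "slope \<delta> * ((1 - real J / 8) * (1 - 316 * \<delta> / 3)) \<le> slope \<delta> * E"
      using slope_pos by simp
    moreover have "slope \<delta> * ((1 - real J / 8) * (1 - 316 * \<delta> / 3)) = 1 - real J / 8"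
      using slope_mult by (metis mult.commute mult.left_commute mult.right_neutral)
    ultimately show ?thesis using W by simp
  qed
qed

end

section \<open>The bags of phase 4 as valued by one remaining agent\<close>

text \<open>The picture when bag f fails: no free good is left, so the bags \<open>D k\<close>
  exhaust \<open>G\<close>. In \<open>fill\<close>, l is the last good put into the bag; before
  that, this agent, still present, did not accept it.\<close>

locale bag_filling =
  fixes u :: "nat \<Rightarrow> real" and G :: "nat set" and N f :: nat and D :: "nat \<Rightarrow> nat set" and \<delta> :: real
  assumes \<delta>: "0 \<le> \<delta>" "\<delta> \<le> 3/956"
    and dec: "decr u G" and f: "f \<in> {1..N}"
    and init: "\<And>k. k \<in> {1..N} \<Longrightarrow> goodsAt G {k, 2*N-k+1, 2*N+k} \<subseteq> D k"
    and ext: "\<And>k. k \<in> {1..N} \<Longrightarrow> D k - goodsAt G {k, 2*N-k+1, 2*N+k} \<subseteq> G - goodsAt G {1..3*N}"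
    and disj: "\<And>k l. k \<in> {1..N} \<Longrightarrow> l \<in> {1..N} \<Longrightarrow> k \<noteq> l \<Longrightarrow> D k \<inter> D l = {}"
    and union: "(\<Union>k\<in>{1..N}. D k) = G"
    and fill: "\<And>k. k \<in> {1..N} \<Longrightarrow> D k = goodsAt G {k, 2*N-k+1, 2*N+k} \<or>
       (\<exists>l\<in>D k - goodsAt G {k, 2*N-k+1, 2*N+k}. sum u (D k - {l}) < 3/4 + \<delta>)"
    and fail: "sum u (D f) < 3/4 + \<delta>"
    and pair: "pval u G 1 + pval u G 2 < 3/4 + \<delta>"
    and R2: "pval u G (2*N-1) + pval u G (2*N) + pval u G (2*N+1) < 3/4 + \<delta>"
    and R3: "pval u G (3*N-2) + pval u G (3*N-1) + pval u G (3*N) + pval u G (3*N+1) < 3/4 + \<delta>"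
begin

abbreviation x where "x \<equiv> pval u G"
abbreviation C where "C k \<equiv> goodsAt G {k, 2*N-k+1, 2*N+k}"

lemma finG: "finite G" using dec by (simp add: decr_def)

lemma u_nonneg: "g \<in> G \<Longrightarrow> 0 \<le> u g" using dec by (simp add: decr_def)

lemma D_sub: "k \<in> {1..N} \<Longrightarrow> D k \<subseteq> G" using union by auto

lemma D_fin: "k \<in> {1..N} \<Longrightarrow> finite (D k)" using D_sub finG finite_subset by blast

lemma x_anti: "1 \<le> p \<Longrightarrow> p \<le> q \<Longrightarrow> x q \<le> x p" using pval_antimono[OF dec] .

lemma sum_G: "(\<Sum>g\<in>G. \<phi> g) = (\<Sum>k\<in>{1..N}. \<Sum>g\<in>D k. \<phi> g)" for \<phi> :: "nat \<Rightarrow> real"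
proof -
  have "(\<Sum>g\<in>(\<Union>k\<in>{1..N}. D k). \<phi> g) = (\<Sum>k\<in>{1..N}. \<Sum>g\<in>D k. \<phi> g)"
    by (rule sum.UNION_disjoint) (use D_fin disj in auto)
  then show ?thesis by (simp only: union)
qed

lemma sum_C:
  assumes "k \<in> {1..N}" "\<phi> 0 = (0::real)"
  shows "(\<Sum>g\<in>C k. \<phi> (u g)) = \<phi> (x k) + \<phi> (x (2*N-k+1)) + \<phi> (x (2*N+k))"
proof -
  have "k \<noteq> 2*N-k+1" "k \<noteq> 2*N+k" "2*N-k+1 \<noteq> 2*N+k" using assms by auto
  then show ?thesis using assms(1) by (subst sum_goodsAt) (auto simp: assms(2))
qed

lemma sum_D:
  fixes \<phi> :: "nat \<Rightarrow> real"
  assumes "k \<in> {1..N}"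
  shows "(\<Sum>g\<in>D k. \<phi> g) = (\<Sum>g\<in>C k. \<phi> g) + (\<Sum>g\<in>D k - C k. \<phi> g)"
  by (rule sum.subset_diff[THEN trans, OF init D_fin]) (use assms in auto)

lemma value_C: "k \<in> {1..N} \<Longrightarrow> sum u (C k) = x k + x (2*N-k+1) + x (2*N+k)"
  using sum_C[of k "\<lambda>z. z"] by simp

lemma pair_less: "k \<in> {1..N} \<Longrightarrow> x k + x (2*N-k+1) < 3/4 + \<delta>"
  using x_anti[of 1 k] x_anti[of 2 "2*N-k+1"] pair by force

text \<open>The last of the three goods in R2 is worth at most a third of their sum. The analogous
  average over the four goods of R3 gives the bound 3/16 + \<delta>/4 in
  \<open>added_less\<close>.\<close>

lemma third_less: "k \<in> {1..N} \<Longrightarrow> x (2*N+k) < 1/4 + \<delta>/3"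
  using x_anti[of "2*N+1" "2*N+k"] x_anti[of "2*N" "2*N+1"] x_anti[of "2*N-1" "2*N"] R2 by force

lemma added_le: "k \<in> {1..N} \<Longrightarrow> g \<in> D k - C k \<Longrightarrow> u g \<le> x (2*N+k)"
  using pval_beyond[OF dec, of g "3*N" "2*N+k"] ext[of k] by auto

lemma added_less:
  assumes "k \<in> {1..N}" "g \<in> D k - C k"
  shows "u g < 3/16 + \<delta>/4"
proof -
  have "u g \<le> x (3*N+1)" using pval_beyond[OF dec, of g "3*N" "3*N+1"] ext[of k] assms by auto
  moreover have "x (3*N+1) \<le> x (3*N)" "x (3*N) \<le> x (3*N-1)" "x (3*N-1) \<le> x (3*N-2)"
    using assms by (auto intro!: x_anti)
  ultimately show ?thesis using R3 by linarith
qed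

lemma filled:
  assumes "k \<in> {1..N}" "D k \<noteq> C k"
  obtains l where "l \<in> D k - C k" "sum u (D k - {l}) < 3/4 + \<delta>" "sum u (D k) = sum u (D k - {l}) + u l"
proof -
  obtain l where l: "l \<in> D k - C k" "sum u (D k - {l}) < 3/4 + \<delta>" using fill assms by blast
  moreover have "sum u (D k) = u l + sum u (D k - {l})"
    using l by (intro sum.remove) (use D_fin assms in auto)
  ultimately show ?thesis using that[of l] by linarith
qed

lemma filled_less:
  assumes "k \<in> {1..N}" "D k \<noteq> C k"
  shows "sum u (D k) < 15/16 + 5/4 * \<delta>"
proof (rule filled[OF assms])
  fix l assume "l \<in> D k - C k" "sum u (D k - {l}) < 3/4 + \<delta>" "sum u (D k) = sum u (D k - {l}) + u l"
  then show ?thesis using added_less[OF assms(1), of l] by linarith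
qed

text \<open>An unfilled bag is a pair below 3/4 + \<delta> and a third good, worth at most 1/4 -
  5\<delta> plus its excess; together 1 - 4\<delta> plus the excess. A filled bag is below 15/16 +
  5\<delta>/4, which is less than 1 - 4\<delta>. The third goods lie beyond position 2N, so the
  potential pays for their excess.\<close>

lemma total_value_le:
  "sum u G \<le> real N * (1 - 4 * \<delta>) + (\<Sum>g\<in>G - goodsAt G {1..2*N}. max 0 (u g - (1/4 - 5 * \<delta>)))"
proof -
  let ?\<psi> = "\<lambda>z::real. max 0 (z - (1/4 - 5 * \<delta>))"
  have "sum u (D k) \<le> (1 - 4 * \<delta>) + ?\<psi> (x (2*N+k))" if k: "k \<in> {1..N}" for k
  proof (cases "D k = C k")
    case True
    then show ?thesis using value_C[OF k] pair_less[OF k] by simp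
  next
    case False
    then show ?thesis using filled_less[OF k False] \<delta> by linarith
  qed
  then have "sum u G \<le> (\<Sum>k\<in>{1..N}. (1 - 4 * \<delta>) + ?\<psi> (x (2*N+k)))"
    unfolding sum_G by (rule sum_mono)
  also have "\<dots> = real N * (1 - 4 * \<delta>) + (\<Sum>k\<in>{1..N}. ?\<psi> (x (2*N+k)))"
    by (simp add: sum.distrib)
  also have "(\<Sum>k\<in>{1..N}. ?\<psi> (x (2*N+k))) = (\<Sum>p\<in>{2*N+1..3*N}. ?\<psi> (x p))"
    by (rule sum.reindex_bij_witness[of _ "\<lambda>p. p - 2*N" "\<lambda>k. 2*N+k"]) auto
  also have "\<dots> = (\<Sum>g\<in>goodsAt G {2*N+1..3*N}. ?\<psi> (u g))"
    by (rule sum_goodsAt[symmetric]) (use \<delta> in auto)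
  also have "\<dots> \<le> (\<Sum>g\<in>G - goodsAt G {1..2*N}. ?\<psi> (u g))"
  proof (rule sum_mono2)
    have "goodsAt G {2*N+1..3*N} \<inter> goodsAt G {1..2*N} = {}" by (rule goodsAt_disjoint) auto
    then show "goodsAt G {2*N+1..3*N} \<subseteq> G - goodsAt G {1..2*N}"
      using goodsAt_subset[of G] by blast
  qed (use finG in auto)
  finally show ?thesis by simp
qed

lemma all_small_imp_False:
  assumes cov: "covers u N G (1 - 12 * \<delta>)"
    and small: "\<And>k. k \<in> {2..N} \<Longrightarrow> sum u (C k) \<le> 1 - 12 * \<delta>"
  shows False
proof -
  let ?\<tau> = "1 - 12 * \<delta>"
  have \<tau>: "0 < ?\<tau>" using \<delta> by simp
  have "real N \<le> (\<Sum>g\<in>G. u g / ?\<tau>)"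
  proof (rule covers_sum_ge[OF cov finG u_nonneg])
    show "1 \<le> (\<Sum>g\<in>S. u g / ?\<tau>)" if "?\<tau> \<le> sum u S" for S
      using that \<tau> by (simp add: sum_divide_distrib[symmetric])
    show "0 \<le> u g / ?\<tau>" if "g \<in> G" for g using u_nonneg[OF that] \<tau> by simp
  qed
  then have tot: "real N * ?\<tau> \<le> sum u G" using \<tau> by (simp add: sum_divide_distrib[symmetric] pos_le_divide_eq)
  \<comment> \<open>A pair and a third good total less than 1 + 4\<delta>/3, which exceeds 1 -
    12\<delta> by 40\<delta>/3; only bag 1 may use this. The failing bag is short by more than 1/4 -
    13\<delta>, which outweighs it.\<close>
  have "sum u (D k) - ?\<tau> \<le> (if k = 1 then 40/3 * \<delta> else 0) + (if k = f then 13 * \<delta> - 1/4 else 0)"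
    if k: "k \<in> {1..N}" for k
  proof -
    have "sum u (D k) \<le> ?\<tau> + (if k = 1 then 40/3 * \<delta> else 0)"
    proof (cases "D k = C k")
      case True
      then show ?thesis
        using small[of k] value_C[OF k] pair_less[OF k] third_less[OF k] k by (auto split: if_splits)
    next
      case False
      then show ?thesis using filled_less[OF k False] \<delta> by auto
    qed
    then show ?thesis using fail \<delta> by auto
  qed
  then have "(\<Sum>k\<in>{1..N}. sum u (D k) - ?\<tau>) \<le>
     (\<Sum>k\<in>{1..N}. (if k = 1 then 40/3 * \<delta> else 0) + (if k = f then 13 * \<delta> - 1/4 else 0))"
    by (rule sum_mono)
  also have "\<dots> = 40/3 * \<delta> + (13 * \<delta> - 1/4)"
    using f by (subst sum.distrib) simp
  finally have "sum u G - real N * ?\<tau> < 0"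
    using \<delta> by (simp add: sum_subtractf sum_G)
  then show False using tot by simp
qed

text \<open>Bags up to k turn out to be acceptable at once, so filled and failing bags come after k.
  There the two leading goods are nearly 3/8 each, leaving only a multiple of \<delta> for
  everything else, so no bag weighs more than 1 and the failing one weighs less.\<close>

lemma some_large_imp_False:
  assumes cov: "covers u N G (1 - 12 * \<delta>)" and k: "k \<in> {2..N}" and large: "1 - 12 * \<delta> < sum u (C k)"
  shows False
proof -
  \<comment> \<open>The value left for x(2N-k+1) when 3/8 + \<delta>/2 for x(k) and 1/4 + \<delta>/3
    for the third good are subtracted from 1 - 12\<delta>.\<close>
  define \<beta> where "\<beta> = 3/8 - 77/6 * \<delta>"
  let ?s = "slope \<delta>" and ?w = "wt \<delta>"
  have k1: "k \<in> {1..N}" using k by auto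
  have half: "x p \<le> 3/8 + \<delta>/2" if "2 \<le> p" for p
    using x_anti[of 2 p] x_anti[of 1 2] pair that by auto
  have sum3: "1 - 12 * \<delta> < x k + x (2*N-k+1) + x (2*N+k)" using large value_C[OF k1] by simp
  have mid: "1/4 - 13 * \<delta> < x p" if "1 \<le> p" "p \<le> 2*N+k" for p
    using sum3 pair_less[OF k1] x_anti[OF that] by linarith
  have big: "\<beta> < x p" if "1 \<le> p" "p \<le> 2*N-k+1" for p
    using sum3 half[of k] third_less[OF k1] x_anti[OF that] k unfolding \<beta>_def by auto
  \<comment> \<open>The three bounds add up to 7/8 - 233\<delta>/6, which is at least 3/4 + \<delta>
    exactly when \<delta> \<le> 3/956.\<close>
  have early: "3/4 + \<delta> \<le> sum u (C j)" if j: "j \<in> {1..k}" for j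
  proof -
    have j1: "j \<in> {1..N}" using j k by auto
    have "\<beta> < x j" using j k by (intro big) auto
    moreover have "1/4 - 13 * \<delta> < x (2*N-j+1)" "1/4 - 13 * \<delta> < x (2*N+j)"
      using j k by (auto intro!: mid)
    ultimately show ?thesis unfolding value_C[OF j1] \<beta>_def using \<delta> by simp
  qed
  have late: "k < j" if j: "j \<in> {1..N}" and X: "C j \<subseteq> X" "X \<subseteq> D j" "sum u X < 3/4 + \<delta>" for j X
  proof (rule ccontr)
    assume "\<not> k < j"
    then have "3/4 + \<delta> \<le> sum u (C j)" using early j by auto
    also have "\<dots> \<le> sum u X"
      by (rule sum_mono2) (use X D_fin[OF j] D_sub[OF j] u_nonneg finite_subset in auto)
    finally show False using X by simp
  qed
  have sb: "?s * \<delta> \<le> 3/640" using slope_bound[OF \<delta>] .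
  have sp: "0 < ?s" using slope_pos[OF \<delta>] .
  have w0: "?w 0 = 0" using wt_zero[OF \<delta>] .
  define W where "W j = (\<Sum>g\<in>D j. ?w (u g))" for j
  \<comment> \<open>Only the two leading goods are charged by the rounded bound 3/8; the third good
    and all added goods are below 1/4 + \<delta>/3 and are charged by slope.\<close>
  have W_late: "W j \<le> 3/4 + ?s * (sum u (D j) - (x j + x (2*N-j+1)))" if j: "j \<in> {1..N}" "k < j" for j
  proof -
    have "W j = ?w (x j) + ?w (x (2*N-j+1)) + ?w (x (2*N+j)) + (\<Sum>g\<in>D j - C j. ?w (u g))"
      unfolding W_def sum_D[OF j(1)] using sum_C[of j ?w] w0 j by simp
    moreover have "?w (x j) \<le> 3/8" "?w (x (2*N-j+1)) \<le> 3/8"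
      by (intro wt_le_three_eighths[OF \<delta>] half; use j k in auto)+
    moreover have "?w (x (2*N+j)) \<le> ?s * x (2*N+j)"
      using third_less[OF j(1)] by (intro wt_le_slope[OF \<delta>]) simp
    moreover have "(\<Sum>g\<in>D j - C j. ?w (u g)) \<le> (\<Sum>g\<in>D j - C j. ?s * u g)"
    proof (rule sum_mono)
      fix g assume "g \<in> D j - C j"
      then have "u g \<le> 1/4 + \<delta>/3" using added_le[OF j(1)] third_less[OF j(1)] by fastforce
      then show "?w (u g) \<le> ?s * u g" by (rule wt_le_slope[OF \<delta>])
    qed
    moreover have "(\<Sum>g\<in>D j - C j. ?s * u g) = ?s * sum u (D j - C j)" by (simp add: sum_distrib_left)
    moreover have "sum u (D j) = x j + x (2*N-j+1) + x (2*N+j) + sum u (D j - C j)"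
      using sum_D[OF j(1), of u] value_C[OF j(1)] by simp
    ultimately show ?thesis by (simp add: algebra_simps)
  qed
  have pair_late: "2 * \<beta> < x j + x (2*N-j+1)" if "j \<in> {1..N}" "k < j" for j
  proof -
    have "\<beta> < x j" "\<beta> < x (2*N-j+1)" using that k by (auto intro!: big)
    then show ?thesis by simp
  qed
  have W_le: "W j \<le> 1" if j: "j \<in> {1..N}" for j
  proof (cases "D j = C j")
    case True
    then have Wj: "W j = ?w (x j) + ?w (x (2*N-j+1)) + ?w (x (2*N+j))"
      unfolding W_def using sum_C[OF j, of ?w] w0 by simp
    have third: "?w (x (2*N+j)) \<le> 1/4" using third_less[OF j] by (intro wt_le_quarter[OF \<delta>]) simp
    show ?thesis
    proof (cases "j = 1")
      case False
      then have "?w (x j) \<le> 3/8" "?w (x (2*N-j+1)) \<le> 3/8"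
        by (intro wt_le_three_eighths[OF \<delta>] half; use j k False in auto)+
      then show ?thesis using Wj third by simp
    next
      case True
      \<comment> \<open>Only the good at position 1 may exceed 3/8 + \<delta>/2. As x(2) > \<beta>,
        the excess is at most 40\<delta>/3, worth 1/16 in weight.\<close>
      have "\<beta> < x 2" using k by (intro big) auto
      then have "x 1 - 3/8 - \<delta>/2 \<le> 40/3 * \<delta>" using pair unfolding \<beta>_def by simp
      then have "?s * (x 1 - 3/8 - \<delta>/2) \<le> ?s * (40/3 * \<delta>)" using sp by simp
      then have w1: "?w (x 1) \<le> 7/16"
      proof (cases "x 1 \<le> 3/8 + \<delta>/2")
        case True
        then show ?thesis using wt_le_three_eighths[OF \<delta> True] by simp
      next
        case False
        then have "?w (x 1) = 3/8 + ?s * (x 1 - 3/8 - \<delta>/2)" using \<delta> by (simp add: wt_def)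
        then show ?thesis using \<open>?s * (x 1 - 3/8 - \<delta>/2) \<le> _\<close> sb by linarith
      qed
      \<comment> \<open>The rule R2 compensates: its third good exceeds 1/4 - 13\<delta>, so x(2N)
        is at most 1/4 + 7\<delta>. The weights 7/16, 9/32 and 1/4 stay below 1.\<close>
      have "x (2*N) \<le> x (2*N-1)" using k by (intro x_anti) auto
      moreover have "1/4 - 13 * \<delta> < x (2*N+1)" using k by (intro mid) auto
      ultimately have x2N: "x (2*N) \<le> 1/4 + 7 * \<delta>" using R2 by linarith
      have "?s * (x (2*N) - 1/4 - \<delta>/3) \<le> ?s * (20/3 * \<delta>)" using sp x2N by simp
      then have w2: "?w (x (2*N)) \<le> 9/32"
        using sb \<delta> x2N by (auto simp: wt_def min_def)
      have "2*N-j+1 = 2*N" using True k by auto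
      then show ?thesis using Wj third w1 w2 True by simp
    qed
  next
    case False
    obtain l where l: "l \<in> D j - C j" "sum u (D j - {l}) < 3/4 + \<delta>"
      "sum u (D j) = sum u (D j - {l}) + u l" by (rule filled[OF j False])
    have kj: "k < j" using l init[OF j] by (intro late[OF j, of "D j - {l}"]) auto
    have "C j \<subseteq> D j - {l}" using l init[OF j] by auto
    then have "sum u (C j) \<le> sum u (D j - {l})"
      by (rule sum_mono2[rotated]) (use D_fin[OF j] D_sub[OF j] u_nonneg in auto)
    \<comment> \<open>The bag without l is below 3/4 + \<delta> and its leading pair above 2\<beta>,
      so what remains is below 80\<delta>/3. The good l is no larger than the third good, which
      doubles this to 160\<delta>/3, of weight at most 1/4.\<close>
    then have "x (2*N+j) < 3/4 + \<delta> - 2 * \<beta>" using l pair_late[OF j kj] value_C[OF j] by simp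
    then have "sum u (D j) - (x j + x (2*N-j+1)) \<le> 160/3 * \<delta>"
      using l added_le[OF j l(1)] pair_late[OF j kj] unfolding \<beta>_def by simp
    then have "?s * (sum u (D j) - (x j + x (2*N-j+1))) \<le> ?s * (160/3 * \<delta>)" using sp by simp
    then show ?thesis using W_late[OF j kj] sb by simp
  qed
  have kf: "k < f" using fail init[OF f] by (intro late[OF f, of "D f"]) auto
  have "sum u (D f) - (x f + x (2*N-f+1)) \<le> 80/3 * \<delta>"
    using fail pair_late[OF f kf] unfolding \<beta>_def by simp
  then have "?s * (sum u (D f) - (x f + x (2*N-f+1))) \<le> ?s * (80/3 * \<delta>)" using sp by simp
  then have Wf: "W f < 1" using W_late[OF f kf] sb by simp
  have "(\<Sum>j\<in>{1..N}. W j) < (\<Sum>j\<in>{1..N}. 1)"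
    by (rule sum_strict_mono_ex1) (use W_le Wf f in auto)
  then have "(\<Sum>g\<in>G. ?w (u g)) < real N" unfolding sum_G W_def by simp
  moreover have "real N \<le> (\<Sum>g\<in>G. ?w (u g))"
  proof (rule covers_sum_ge[OF cov finG u_nonneg])
    show "1 \<le> (\<Sum>g\<in>S. ?w (u g))" if "S \<subseteq> G" "1 - 12 * \<delta> \<le> sum u S" for S
      using that finG u_nonneg by (intro wt_sum_ge_one[OF \<delta>]) (auto intro: finite_subset)
    show "0 \<le> ?w (u g)" if "g \<in> G" for g using u_nonneg[OF that] by (rule wt_nonneg[OF \<delta>])
  qed
  ultimately show False by simp
qed

lemma covers_imp_False: "covers u N G (1 - 12 * \<delta>) \<Longrightarrow> False"
  using all_small_imp_False some_large_imp_False by (meson not_le)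

end

text \<open>Put t = 2n - k + 1; good t is worth more than 1/3. Hence no part of the partition holds
  three of the first t goods, and a part holding one of the first k goods holds no other of them. So
  t \<le> k + 2(n - k), which is t - 1.\<close>

lemma heavy_pair_contradiction:
  fixes f :: "nat \<Rightarrow> nat"
  assumes anti: "\<And>g h. 1 \<le> g \<Longrightarrow> g \<le> h \<Longrightarrow> h \<le> m \<Longrightarrow> u h \<le> (u g :: real)"
    and nn: "\<And>g. g \<in> {1..m} \<Longrightarrow> 0 \<le> u g"
    and f: "\<And>g. g \<in> {1..m} \<Longrightarrow> f g < n"
    and one: "\<And>q. q < n \<Longrightarrow> (\<Sum>g\<in>{g\<in>{1..m}. f g = q}. u g) = 1"
    and k: "k \<in> {1..n}" and m: "2*n-k+1 \<le> m"
    and heavy: "u k + u (2*n-k+1) > 1" and first: "u 1 \<le> 2/3"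
  shows False
proof -
  define t where "t = 2*n-k+1"
  have kt: "k < t" "t \<le> m" "1 \<le> k" using k m unfolding t_def by auto
  have ut: "u t > 1/3" using anti[of 1 k] kt heavy first unfolding t_def by auto
  define c where "c q = {g\<in>{1..t}. f g = q}" for q
  have part_le: "sum u S \<le> 1" if "q < n" "S \<subseteq> c q" for q S
    unfolding one[OF that(1), symmetric] by (rule sum_mono2) (use that nn kt in \<open>auto simp: c_def\<close>)
  have c2: "card (c q) \<le> 2" if q: "q < n" for q
  proof (rule ccontr)
    assume "\<not> ?thesis"
    then have c3: "3 \<le> card (c q)" by simp
    have "real (card (c q)) * u t \<le> sum u (c q)"
      by (rule sum_bounded_below) (use anti kt in \<open>auto simp: c_def\<close>)
    moreover have "3 * u t \<le> real (card (c q)) * u t" using c3 ut by (intro mult_right_mono) auto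
    moreover have "sum u (c q) \<le> 1" by (rule part_le[OF q]) simp
    ultimately show False using ut by linarith
  qed
  have single: "h = g" if g: "g \<in> {1..k}" and h: "h \<in> {1..t}" "f h = f g" for g h
  proof (rule ccontr)
    assume "h \<noteq> g"
    have "f g < n" using f g kt by auto
    then have "sum u {g, h} \<le> 1" by (rule part_le) (use g h kt in \<open>auto simp: c_def\<close>)
    moreover have "u k \<le> u g" "u t \<le> u h" using anti g h kt by auto
    ultimately show False using heavy \<open>h \<noteq> g\<close> unfolding t_def by auto
  qed
  define K where "K = f ` {1..k}"
  have cardK: "card K = k" unfolding K_def
    using kt single by (subst card_image) (auto intro!: inj_onI)
  have KN: "K \<subseteq> {..<n}" unfolding K_def using f kt by auto
  have c1: "card (c q) \<le> 1" if q: "q \<in> K" for q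
  proof -
    obtain g where "g \<in> {1..k}" "q = f g" using q unfolding K_def by auto
    then have "c q \<subseteq> {g}" using single by (auto simp: c_def)
    then show ?thesis using card_mono[of "{g}" "c q"] by simp
  qed
  have "t = (\<Sum>q<n. card (c q))"
    using sum.group[of "{1..t}" "{..<n}" f "\<lambda>_. 1::nat"] f kt by (auto simp: c_def image_subset_iff)
  also have "\<dots> = (\<Sum>q\<in>{..<n} - K. card (c q)) + (\<Sum>q\<in>K. card (c q))"
    by (rule sum.subset_diff) (use KN in auto)
  also have "\<dots> \<le> (\<Sum>q\<in>{..<n} - K. 2) + (\<Sum>q\<in>K. 1)"
    by (intro add_mono sum_mono) (use c2 c1 in auto)
  also have "\<dots> = 2 * (n - k) + k"
    using KN cardK by (simp add: card_Diff_subset finite_subset)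
  finally show False using k unfolding t_def by auto
qed

section \<open>Invariants of the phases\<close>

lemma sum_triple: "a \<noteq> b \<Longrightarrow> a \<noteq> c \<Longrightarrow> b \<noteq> c \<Longrightarrow> sum h {a, b, c} = h a + h b + (h c :: real)"
  by simp

lemma sum_quadruple:
  "a \<noteq> b \<Longrightarrow> a \<noteq> c \<Longrightarrow> a \<noteq> d \<Longrightarrow> b \<noteq> c \<Longrightarrow> b \<noteq> d \<Longrightarrow> c \<noteq> d \<Longrightarrow>
   sum h {a, b, c, d} = h a + h b + h c + (h d :: real)"
  by simp

lemma R2_positions: "0 < d \<Longrightarrow> {2*d-1, 2*d, 2*d+1} = {2*(d-1)+1..2*d+1}" for d :: nat
  by (cases d) auto

lemma R3_positions: "0 < d \<Longrightarrow> {3*d-2, 3*d-1, 3*d, 3*d+1} = {3*(d-1)+1..3*d+1}" for d :: nat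
  by (cases d) auto

text \<open>The potential of the amortised analysis for priority agents: rule R3 may push goods of value
  above y beyond position 2d, which makes later applications of R2 more expensive.\<close>

definition psi :: "real \<Rightarrow> (nat \<Rightarrow> real) \<Rightarrow> nat set \<Rightarrow> nat \<Rightarrow> real" where
  "psi y u G d = (\<Sum>g\<in>G - goodsAt G {1..2*d}. max 0 (u g - y))"

text \<open>A capped value plus the excess of a value dominating it is at most the latter. This is
  the cost of R3: A, B, C are the three goods of R2, and only the two at positions 2d - 1 and 2d add
  excess to the potential.\<close>

lemma capped_sum_le:
  fixes a b c d A B C y :: real
  assumes "a \<le> A" "b \<le> B" "c \<le> C"
  shows "min a y + min b y + min c y + min d y + max 0 (A - y) + max 0 (B - y) \<le> A + B + C + y"
proof -
  have "min a y + max 0 (A - y) \<le> A" "min b y + max 0 (B - y) \<le> B" "min c y \<le> C" "min d y \<le> y"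
    using assms by auto
  then have "(min a y + max 0 (A - y)) + (min b y + max 0 (B - y)) + min c y + min d y \<le> A + B + C + y"
    by (intro add_mono)
  then show ?thesis by (simp add: algebra_simps)
qed

text \<open>Split each removed value into its part below y and its excess. Replacing d by d - 1
  brings the excess of positions 2d - 1 and 2d into the potential, while the excess of removed goods
  leaves it. No removed position is below 2d - 1, so the top segment is unchanged.\<close>

lemma psi_removal:
  assumes dec: "decr u G" and d: "0 < d" and J: "finite J" "J \<subseteq> {2*d-1..}" and y: "0 \<le> y"
  shows "sum u (goodsAt G J) + psi y u (G - goodsAt G J) (d - 1) =
    (\<Sum>p\<in>J. min (pval u G p) y) + max 0 (pval u G (2*d-1) - y) + max 0 (pval u G (2*d) - y) + psi y u G d"
proof -
  let ?h = "\<lambda>z. max 0 (z - y)"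
  let ?R = "goodsAt G J" and ?T = "goodsAt G {1..2*(d-1)}" and ?B = "goodsAt G {2*d-1, 2*d}"
  have fin: "finite G" using dec by (simp add: decr_def)
  have finR: "finite ?R" by (rule finite_subset[OF goodsAt_subset fin])
  have RT: "?R \<inter> ?T = {}" using J d by (intro goodsAt_disjoint) fastforce
  have "sum u ?R = (\<Sum>g\<in>?R. min (u g) y + ?h (u g))" by (intro sum.cong) auto
  also have "\<dots> = (\<Sum>p\<in>J. min (pval u G p) y) + (\<Sum>g\<in>?R. ?h (u g))"
    by (subst sum.distrib, subst sum_goodsAt[where \<phi> = "\<lambda>z. min z y"]) (use J d y in auto)
  finally have 1: "sum u ?R = (\<Sum>p\<in>J. min (pval u G p) y) + (\<Sum>g\<in>?R. ?h (u g))" .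
  have "psi y u (G - ?R) (d - 1) = (\<Sum>g\<in>G - ?T - ?R. ?h (u g))"
    unfolding psi_def goodsAt_diff_initial[OF fin goodsAt_subset RT] by (intro sum.cong) auto
  moreover have "(\<Sum>g\<in>G - ?T. ?h (u g)) = (\<Sum>g\<in>G - ?T - ?R. ?h (u g)) + (\<Sum>g\<in>?R. ?h (u g))"
    by (rule sum.subset_diff) (use fin RT goodsAt_subset in auto)
  ultimately have 2: "psi y u (G - ?R) (d - 1) + (\<Sum>g\<in>?R. ?h (u g)) = (\<Sum>g\<in>G - ?T. ?h (u g))" by simp
  have "{1..2*d} = {1..2*(d-1)} \<union> {2*d-1, 2*d}" using d by auto
  then have top: "goodsAt G {1..2*d} = ?T \<union> ?B" by (metis goodsAt_Un)
  have BT: "?B \<inter> ?T = {}" by (rule goodsAt_disjoint) (use d in auto)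
  have "(\<Sum>g\<in>G - ?T. ?h (u g)) = (\<Sum>g\<in>G - ?T - ?B. ?h (u g)) + (\<Sum>g\<in>?B. ?h (u g))"
    by (rule sum.subset_diff) (use fin BT goodsAt_subset in auto)
  moreover have "(\<Sum>g\<in>G - ?T - ?B. ?h (u g)) = psi y u G d"
    unfolding psi_def top by (intro sum.cong) auto
  moreover have "(\<Sum>g\<in>?B. ?h (u g)) = ?h (pval u G (2*d-1)) + ?h (pval u G (2*d))"
    by (subst sum_goodsAt) (use d y in auto)
  ultimately show ?thesis using 1 2 by linarith
qed

text \<open>X is the set of goods that may still be given away; keeping finished bundles disjoint
  from it makes later bundles disjoint from them.\<close>

definition alloc_ok :: "nat \<Rightarrow> nat \<Rightarrow> valuation \<Rightarrow> real \<Rightarrow> nat set \<Rightarrow> (nat \<Rightarrow> nat set) \<Rightarrow> nat set \<Rightarrow> bool" where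
  "alloc_ok n m v \<alpha> Ag al X \<longleftrightarrow>
     (\<forall>i\<in>{1..n} - Ag. al i \<subseteq> {1..m} \<and> \<alpha> \<le> val m v i (al i) \<and> al i \<inter> X = {}) \<and>
     (\<forall>i\<in>{1..n} - Ag. \<forall>j\<in>{1..n} - Ag. i \<noteq> j \<longrightarrow> al i \<inter> al j = {})"

lemma alloc_ok_give:
  assumes "alloc_ok n m v \<alpha> Ag al X" "i \<in> Ag" "S \<subseteq> X" "S \<subseteq> {1..m}" "\<alpha> \<le> val m v i S" "Y \<subseteq> X - S"
  shows "alloc_ok n m v \<alpha> (Ag - {i}) (al(i := S)) Y"
proof -
  have mem: "j = i \<or> j \<in> {1..n} - Ag" if "j \<in> {1..n} - (Ag - {i})" for j using that by auto
  have 1: "al j \<subseteq> {1..m}" "\<alpha> \<le> val m v j (al j)" "al j \<inter> X = {}" if "j \<in> {1..n} - Ag" for j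
    using assms(1) that unfolding alloc_ok_def by auto
  have 2: "al j \<inter> al k = {}" if "j \<in> {1..n} - Ag" "k \<in> {1..n} - Ag" "j \<noteq> k" for j k
    using assms(1) that unfolding alloc_ok_def by auto
  show ?thesis unfolding alloc_ok_def
  proof (intro conjI ballI impI)
    fix j assume j: "j \<in> {1..n} - (Ag - {i})"
    show "(al(i := S)) j \<subseteq> {1..m}" "\<alpha> \<le> val m v j ((al(i := S)) j)"
      using mem[OF j] 1[of j] assms by auto
    show "(al(i := S)) j \<inter> Y = {}"
      using mem[OF j] 1(3)[of j] assms(6) by (cases "j = i") auto
    fix k assume k: "k \<in> {1..n} - (Ag - {i})" and jk: "j \<noteq> k"
    show "(al(i := S)) j \<inter> (al(i := S)) k = {}"
      using mem[OF j] mem[OF k] 1(3)[of j] 1(3)[of k] 2[of j k] jk assms(3)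
      by (cases "j = i"; cases "k = i") auto
  qed
qed

lemma alloc_ok_mono: "alloc_ok n m v \<alpha> Ag al X \<Longrightarrow> Y \<subseteq> X \<Longrightarrow> alloc_ok n m v \<alpha> Ag al Y"
  unfolding alloc_ok_def by blast

section \<open>Consequences of the hypotheses for single agents\<close>

locale ONI_instance =
  fixes n m :: nat and v :: valuation and \<delta> :: real
  assumes \<delta>: "0 \<le> \<delta>" "\<delta> \<le> 3/956"
    and nonneg: "nonneg_additive n m v"
    and oni: "ONI n m v \<delta>"
    and many: "real (card (N11 n m v \<delta>)) > real n * (1/4 - \<delta>) / (1/4 + \<delta>/3)"
begin

abbreviation "\<alpha> \<equiv> 3/4 + \<delta>"
abbreviation "P \<equiv> prio n m v \<delta>"

lemma N11_sub: "N11 n m v \<delta> \<subseteq> {1..n}" unfolding N11_def N1_def by auto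

lemma P_eq: "P = {1..n} - N11 n m v \<delta>"
  unfolding prio_def N12_def N2_def N11_def N1_def by auto

lemma n_pos: "0 < n"
  using many by (rule_tac ccontr) (simp add: N11_def N1_def)

text \<open>A member of \<open>N11\<close> exists and values good 2n + 1 positively, so this good is
  not a dummy.\<close>

lemma m_ge: "2*n+1 \<le> m"
proof -
  have "0 \<le> real n * (1/4 - \<delta>) / (1/4 + \<delta>/3)" using \<delta> by simp
  then have "0 < card (N11 n m v \<delta>)" using many by linarith
  then obtain i where "i \<in> N11 n m v \<delta>" by (metis card.empty ex_in_conv less_nat_zero_code)
  then have "0 < val m v i {2*n+1}" using \<delta> unfolding N11_def by auto
  then show ?thesis unfolding val_def by (cases "2*n+1 \<le> m") auto
qed

lemma val_sum: "S \<subseteq> {1..m} \<Longrightarrow> val m v i S = sum (v i) S"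
  unfolding val_def by (simp add: Int_absorb2)

lemma v_nonneg: "i \<in> {1..n} \<Longrightarrow> g \<in> {1..m} \<Longrightarrow> 0 \<le> v i g"
  using nonneg unfolding nonneg_additive_def by auto

lemma v_anti: "i \<in> {1..n} \<Longrightarrow> 1 \<le> g \<Longrightarrow> g \<le> h \<Longrightarrow> h \<le> m \<Longrightarrow> v i h \<le> v i g"
  using oni unfolding ONI_def ordered_def by blast

lemma v_decr: "i \<in> {1..n} \<Longrightarrow> G \<subseteq> {1..m} \<Longrightarrow> decr (v i) G"
  unfolding decr_def
  by (intro conjI ballI impI finite_subset[of G "{1..m}"]) (auto simp: subset_iff intro: v_nonneg v_anti)

lemma first_less: "i \<in> {1..n} \<Longrightarrow> v i 1 < \<alpha>"
  using oni m_ge unfolding ONI_def irreducible_def by (auto simp: val_def)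

lemma first_plus_less: "i \<in> {1..n} \<Longrightarrow> v i 1 + v i (2*n+1) < \<alpha>"
  using oni m_ge n_pos unfolding ONI_def irreducible_def by (auto simp: val_sum)

lemma normal_partition:
  assumes "i \<in> {1..n}"
  shows "\<exists>f. (\<forall>g\<in>{1..m}. f g < n) \<and> (\<forall>k<n. (\<Sum>g\<in>{g\<in>{1..m}. f g = k}. v i g) = 1)"
proof -
  have "normalized n m v" using oni unfolding ONI_def by simp
  then obtain f where "f \<in> Pi {1..m} (\<lambda>_. {..<n})" "\<forall>k<n. (\<Sum>g\<in>{g\<in>{1..m}. f g = k}. v i g) = 1"
    using assms unfolding normalized_def by blast
  then show ?thesis by (intro exI[of _ f]) (auto simp: Pi_iff)
qed

lemma MMS_one:
  assumes "i \<in> {1..n}"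
  shows "MMS n m v i = 1"
proof -
  have "normalized n m v" using oni unfolding ONI_def by simp
  then obtain f where f: "Min ((\<lambda>k. \<Sum>g\<in>{g\<in>{1..m}. f g = k}. v i g) ` {..<n}) = MMS n m v i"
     "\<forall>k<n. (\<Sum>g\<in>{g\<in>{1..m}. f g = k}. v i g) = 1"
    using assms unfolding normalized_def by blast
  have "(\<lambda>k. \<Sum>g\<in>{g\<in>{1..m}. f g = k}. v i g) ` {..<n} = (\<lambda>_. 1) ` {..<n}"
    by (rule image_cong) (use f in auto)
  also have "\<dots> = {1}" using n_pos by auto
  finally show ?thesis using f by simp
qed

lemma total_value:
  assumes "i \<in> {1..n}"
  shows "sum (v i) {1..m} = real n"
proof -
  obtain f where f: "\<forall>g\<in>{1..m}. f g < n" "\<forall>k<n. (\<Sum>g\<in>{g\<in>{1..m}. f g = k}. v i g) = 1"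
    using normal_partition[OF assms] by blast
  have "sum (v i) {1..m} = (\<Sum>k\<in>{..<n}. \<Sum>g\<in>{g\<in>{1..m}. f g = k}. v i g)"
    by (rule sum.group[symmetric]) (use f in auto)
  also have "\<dots> = real n" using f by simp
  finally show ?thesis .
qed

lemma Bbag_eq: "k \<in> {1..n} \<Longrightarrow> Bbag n m k = {k, 2*n-k+1}"
  unfolding Bbag_def using m_ge by auto

text \<open>For \<open>N12\<close> this is the definition. An agent of \<open>N2\<close> violating
  it would, by irreducibility for {1, 2n+1}, value good 1 below 1/2 + 6\<delta> \<le> 2/3, and its
  pair worth more than 1 contradicts normalization.\<close>

lemma prio_small:
  assumes "i \<in> P"
  shows "v i (2*n+1) < 1/4 - 5*\<delta>"
proof (rule ccontr)
  assume a: "\<not> ?thesis"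
  have i: "i \<in> {1..n}" using assms unfolding P_eq by auto
  have "val m v i {2*n+1} = v i (2*n+1)" using m_ge by (simp add: val_sum)
  then have "i \<notin> N1 n m v" using a assms unfolding P_eq N11_def by auto
  then obtain k where k: "k \<in> {1..n}" "1 < val m v i (Bbag n m k)" using i unfolding N1_def by auto
  have "k \<noteq> 2*n-k+1" "{k, 2*n-k+1} \<subseteq> {1..m}" using k m_ge by auto
  then have heavy: "1 < v i k + v i (2*n-k+1)" using k Bbag_eq[OF k(1)] by (simp add: val_sum)
  have first: "v i 1 \<le> 2/3" using first_plus_less[OF i] a \<delta> by simp
  obtain f where f: "\<forall>g\<in>{1..m}. f g < n" "\<forall>k<n. (\<Sum>g\<in>{g\<in>{1..m}. f g = k}. v i g) = 1"
    using normal_partition[OF i] by blast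
  show False
    by (rule heavy_pair_contradiction[of m "v i" f n k]) (use f k heavy first v_anti[OF i] v_nonneg[OF i] m_ge in auto)
qed

lemma nonprio_first:
  assumes "i \<in> {1..n}" "i \<notin> P"
  shows "v i 1 < 1/2 + 6*\<delta>"
proof -
  have "i \<in> N11 n m v \<delta>" using assms unfolding P_eq by auto
  then have "1/4 - 5*\<delta> \<le> v i (2*n+1)" using m_ge unfolding N11_def by (simp add: val_sum)
  then show ?thesis using first_plus_less[OF assms(1)] by simp
qed

text \<open>The complement of \<open>many\<close>, multiplied out: (1/4 + \<delta>/3) - (1/4 -
  \<delta>) = 4\<delta>/3.\<close>

lemma card_P: "real (card P) * (1/4 + \<delta>/3) < real n * (4/3 * \<delta>)"
proof -
  have "card P = n - card (N11 n m v \<delta>)" unfolding P_eq using N11_sub by (simp add: card_Diff_subset finite_subset)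
  moreover have "card (N11 n m v \<delta>) \<le> n" using card_mono[OF _ N11_sub] by simp
  ultimately have eq: "real (card (N11 n m v \<delta>)) = real n - real (card P)" by simp
  have "real n * (1/4 - \<delta>) < real (card (N11 n m v \<delta>)) * (1/4 + \<delta>/3)"
    using many \<delta> by (simp add: pos_divide_less_eq)
  then show ?thesis unfolding eq by (simp add: algebra_simps)
qed

section \<open>Phases 1 and 2: removal of pairs\<close>

text \<open>A remaining priority agent pays 1 - 4\<delta> per removed agent, and 1/2 + 6\<delta>
  more for a removed priority agent, since 2\<alpha> = (1 - 4\<delta>) + (1/2 + 6\<delta>).\<close>

definition inv_phase12 :: "nat set \<Rightarrow> nat set \<Rightarrow> (nat \<Rightarrow> nat set) \<Rightarrow> bool" where
  "inv_phase12 Ag G al \<longleftrightarrow> Ag \<subseteq> {1..n} \<and> G \<subseteq> {1..m} \<and> {2*n+1..m} \<subseteq> G \<and> card (G \<inter> {1..2*n}) = 2 * card Ag \<and>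
     alloc_ok n m v \<alpha> Ag al G \<and>
     (\<forall>i\<in>Ag \<inter> P. sum (v i) ({1..m} - G) \<le> (1 - 4*\<delta>) * (real n - real (card Ag)) + (1/2 + 6*\<delta>) * real (card (P - Ag)))"

lemma inv_phase12_give:
  assumes inv: "inv_phase12 Ag G al" and i: "i \<in> Ag" and S: "S \<subseteq> G" "S \<subseteq> {1..2*n}" "card S = 2"
    and val: "\<alpha> \<le> val m v i S"
    and pr: "\<And>j. j \<in> Ag \<inter> P \<Longrightarrow> i \<notin> P \<Longrightarrow> val m v j S < \<alpha>"
  shows "inv_phase12 (Ag - {i}) (G - S) (al(i := S))"
proof -
  have I: "Ag \<subseteq> {1..n}" "G \<subseteq> {1..m}" "{2*n+1..m} \<subseteq> G" "card (G \<inter> {1..2*n}) = 2 * card Ag" "alloc_ok n m v \<alpha> Ag al G"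
    using inv unfolding inv_phase12_def by auto
  have finAg: "finite Ag" using I(1) by (rule finite_subset) simp
  have cAg: "card (Ag - {i}) = card Ag - 1" "0 < card Ag" using i finAg by (auto simp: card_gt_0_iff)
  then have rAg: "real (card (Ag - {i})) = real (card Ag) - 1" by linarith
  have Sm: "S \<subseteq> {1..m}" using S I by auto
  have finS: "finite S" using S by (auto intro: finite_subset)
  have "(G - S) \<inter> {1..2*n} = (G \<inter> {1..2*n}) - S" by auto
  then have cG: "card ((G - S) \<inter> {1..2*n}) = 2 * card (Ag - {i})"
    using S I finS cAg by (simp add: card_Diff_subset)
  have val2: "sum (v j) S \<le> 2 * \<alpha>" if "j \<in> {1..n}" for j
  proof -
    have "sum (v j) S \<le> real (card S) * \<alpha>"
    proof (rule sum_bounded_above)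
      fix g assume "g \<in> S"
      then have "v j g \<le> v j 1" using Sm by (intro v_anti[OF that]) auto
      then show "v j g \<le> \<alpha>" using first_less[OF that] by simp
    qed
    then show ?thesis using S by simp
  qed
  have "sum (v j) ({1..m} - (G - S)) \<le> (1 - 4*\<delta>) * (real n - real (card (Ag - {i}))) + (1/2 + 6*\<delta>) * real (card (P - (Ag - {i})))"
    if j: "j \<in> (Ag - {i}) \<inter> P" for j
  proof -
    have "{1..m} - (G - S) = ({1..m} - G) \<union> S" using Sm by auto
    then have "sum (v j) ({1..m} - (G - S)) = sum (v j) (({1..m} - G) \<union> S)" by simp
    also have "\<dots> = sum (v j) ({1..m} - G) + sum (v j) S"
      by (rule sum.union_disjoint) (use finS S in auto)
    finally have 1: "sum (v j) ({1..m} - (G - S)) = sum (v j) ({1..m} - G) + sum (v j) S" .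
    have 2: "sum (v j) ({1..m} - G) \<le> (1 - 4*\<delta>) * (real n - real (card Ag)) + (1/2 + 6*\<delta>) * real (card (P - Ag))"
      using inv j unfolding inv_phase12_def by auto
    have finP: "finite P" unfolding P_eq by auto
    show ?thesis
    proof (cases "i \<in> P")
      case True
      then have "P - (Ag - {i}) = insert i (P - Ag)" using i by auto
      then have "real (card (P - (Ag - {i}))) = real (card (P - Ag)) + 1" using i finP by simp
      moreover have "sum (v j) S \<le> 2 * \<alpha>" using val2 j I by auto
      ultimately show ?thesis unfolding 1 rAg using 2 by (simp add: algebra_simps)
    next
      \<comment> \<open>The priority rule: a pair goes to a non-priority agent only if no remaining
        priority agent accepts it, so it costs less than \<alpha> \<le> 1 - 4\<delta>.\<close>
      case False
      then have "P - (Ag - {i}) = P - Ag" by auto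
      moreover have "sum (v j) S < \<alpha>" using pr[of j] False j val_sum[OF Sm] by simp
      ultimately show ?thesis unfolding 1 rAg using 2 \<delta> by (simp add: algebra_simps)
    qed
  qed
  moreover have "alloc_ok n m v \<alpha> (Ag - {i}) (al(i := S)) (G - S)"
    by (rule alloc_ok_give[OF I(5) i S(1) Sm val]) simp
  ultimately show ?thesis unfolding inv_phase12_def using I cG S by auto
qed

section \<open>Phase 3: the rules R2 and R3\<close>

definition agent_ok :: "nat \<Rightarrow> nat set \<Rightarrow> nat \<Rightarrow> bool" where
  "agent_ok i G d \<longleftrightarrow> pval (v i) G 1 + pval (v i) G 2 < \<alpha> \<and>
     (i \<in> P \<longrightarrow> sum (v i) ({1..m} - G) + psi (1/4 - 5*\<delta>) (v i) G d \<le>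
        (1 - 4*\<delta>) * (real n - real d) + (1/2 + 6*\<delta>) * real (card P)) \<and>
     (i \<notin> P \<longrightarrow> covers (v i) d G (1 - 12*\<delta>))"

definition inv_phase3 :: "nat set \<Rightarrow> nat set \<Rightarrow> (nat \<Rightarrow> nat set) \<Rightarrow> bool" where
  "inv_phase3 Ag G al \<longleftrightarrow> Ag \<subseteq> {1..n} \<and> G \<subseteq> {1..m} \<and> alloc_ok n m v \<alpha> Ag al G \<and> (\<forall>i\<in>Ag. agent_ok i G (card Ag))"

lemma val_goodsAt:
  assumes "G \<subseteq> {1..m}" "finite J" "0 \<notin> J"
  shows "val m v i (goodsAt G J) = (\<Sum>p\<in>J. pval (v i) G p)"
proof -
  have "goodsAt G J \<subseteq> {1..m}" using goodsAt_subset assms(1) by blast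
  then show ?thesis using sum_goodsAt[OF assms(2,3), where \<phi> = "\<lambda>z. z"] by (simp add: val_sum)
qed

lemma inv_phase12_top:
  assumes "inv_phase12 Ag G al"
  shows "goodsAt G {1..2 * card Ag} = G \<inter> {1..2*n}"
proof -
  have I: "G \<subseteq> {1..m}" "card (G \<inter> {1..2*n}) = 2 * card Ag" using assms unfolding inv_phase12_def by auto
  have fin: "finite G" using I(1) by (rule finite_subset) simp
  then have "card (G \<inter> {1..2*n}) \<le> card G" by (intro card_mono) auto
  then show ?thesis using I fin by (intro goodsAt_initial_eq) auto
qed

lemma inv_phase12_imp_inv3:
  assumes inv: "inv_phase12 Ag G al" and small: "\<And>i. i \<in> Ag \<Longrightarrow> val m v i (goodsAt G {1,2}) < \<alpha>"
  shows "inv_phase3 Ag G al"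
proof -
  have I: "Ag \<subseteq> {1..n}" "G \<subseteq> {1..m}" "{2*n+1..m} \<subseteq> G" "card (G \<inter> {1..2*n}) = 2 * card Ag" "alloc_ok n m v \<alpha> Ag al G"
    using inv unfolding inv_phase12_def by auto
  have finG: "finite G" using I(2) by (rule finite_subset) simp
  have cAg: "card Ag \<le> n" using card_mono[OF _ I(1)] by simp
  have "agent_ok i G (card Ag)" if i: "i \<in> Ag" for i
    unfolding agent_ok_def
  proof (intro conjI impI)
    have iN: "i \<in> {1..n}" using i I by auto
    show "pval (v i) G 1 + pval (v i) G 2 < \<alpha>"
      using small[OF i] val_goodsAt[OF I(2), of "{1,2}" i] by simp
    show "sum (v i) ({1..m} - G) + psi (1/4 - 5*\<delta>) (v i) G (card Ag) \<le>
        (1 - 4*\<delta>) * (real n - real (card Ag)) + (1/2 + 6*\<delta>) * real (card P)" if P: "i \<in> P"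
    proof -
      \<comment> \<open>The potential starts at 0: goods beyond position 2|Ag| have original index
        above 2n and are worth at most v(2n+1) < 1/4 - 5\<delta>.\<close>
      have "psi (1/4 - 5*\<delta>) (v i) G (card Ag) = (\<Sum>g\<in>G - {1..2*n}. max 0 (v i g - (1/4 - 5*\<delta>)))"
        unfolding psi_def inv_phase12_top[OF inv] by (intro sum.cong) auto
      also have "\<dots> = (\<Sum>g\<in>G - {1..2*n}. 0)"
      proof (rule sum.cong[OF refl])
        fix g assume "g \<in> G - {1..2*n}"
        then have "v i g \<le> v i (2*n+1)" using I by (intro v_anti[OF iN]) auto
        then show "max 0 (v i g - (1/4 - 5*\<delta>)) = 0" using prio_small[OF P] by simp
      qed
      finally have "psi (1/4 - 5*\<delta>) (v i) G (card Ag) = 0" by simp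
      moreover have "sum (v i) ({1..m} - G) \<le> (1 - 4*\<delta>) * (real n - real (card Ag)) + (1/2 + 6*\<delta>) * real (card (P - Ag))"
        using inv i P unfolding inv_phase12_def by auto
      moreover have "card (P - Ag) \<le> card P" by (rule card_mono) (auto simp: P_eq)
      then have "(1/2 + 6*\<delta>) * real (card (P - Ag)) \<le> (1/2 + 6*\<delta>) * real (card P)"
        using \<delta> by (intro mult_left_mono) auto
      ultimately show ?thesis by linarith
    qed
    show "covers (v i) (card Ag) G (1 - 12*\<delta>)" if P: "i \<notin> P"
    proof -
      obtain f where f: "\<forall>g\<in>{1..m}. f g < n" "\<forall>k<n. (\<Sum>g\<in>{g\<in>{1..m}. f g = k}. v i g) = 1"
        using normal_partition[OF iN] by blast
      have "g \<le> 2*n" if "g \<in> {1..m} - G" for g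
      proof (rule ccontr)
        assume "\<not> g \<le> 2*n"
        then have "g \<in> {2*n+1..m}" using that by auto
        then show False using that I(3) by blast
      qed
      then have "{1..m} - G = {1..2*n} - (G \<inter> {1..2*n})" using I(2) m_ge by auto
      moreover have "card ({1..2*n} - (G \<inter> {1..2*n})) = 2*n - 2 * card Ag"
        using I by (subst card_Diff_subset) auto
      ultimately have c: "card ({1..m} - G) \<le> 2 * (n - card Ag)" by simp
      \<comment> \<open>Two goods went per removed agent, each worth at most 1/2 + 6\<delta>; hence
        e = 6\<delta> and bundles of value 1 - 12\<delta>.\<close>
      have "covers (v i) (n - (n - card Ag)) ({1..m} - ({1..m} - G)) (1 - 2 * (6*\<delta>))"
      proof (rule covers_after_removal[of "{..<n}" n "{1..m}" "v i" f])
        show "v i g \<le> 1/2 + 6*\<delta>" if "g \<in> {1..m} - G" for g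
          using v_anti[OF iN, of 1 g] nonprio_first[OF iN P] that by auto
      qed (use f v_nonneg[OF iN] c \<delta> in auto)
      moreover have "{1..m} - ({1..m} - G) = G" using I by auto
      ultimately show ?thesis using cAg by simp
    qed
  qed
  then show ?thesis unfolding inv_phase3_def using I by auto
qed

lemma agent_ok_removal:
  assumes ok: "agent_ok i G d" and i: "i \<in> {1..n}" and G: "G \<subseteq> {1..m}" and d: "0 < d" and j: "j = 2 \<or> j = 3"
    and R2: "j = 3 \<Longrightarrow> pval (v i) G (2*d-1) + pval (v i) G (2*d) + pval (v i) G (2*d+1) < \<alpha>"
  shows "agent_ok i (G - goodsAt G {j*(d-1)+1..j*d+1}) (d - 1)"
proof -
  let ?J = "{j*(d-1)+1..j*d+1}" and ?x = "pval (v i) G" and ?y = "1/4 - 5*\<delta>"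
  let ?R = "goodsAt G ?J"
  have dec: "decr (v i) G" by (rule v_decr[OF i G])
  have finG: "finite G" using G by (rule finite_subset) simp
  have anti: "?x q \<le> ?x p" if "1 \<le> p" "p \<le> q" for p q using pval_antimono[OF dec that] .
  have pair: "?x 1 + ?x 2 < \<alpha>" using ok unfolding agent_ok_def by simp
  show ?thesis unfolding agent_ok_def
  proof (intro conjI impI)
    have "pval (v i) (G - ?R) p \<le> ?x p" for p by (rule pval_subset_le[OF dec]) auto
    from this[of 1] this[of 2] show "pval (v i) (G - ?R) 1 + pval (v i) (G - ?R) 2 < \<alpha>"
      using pair by linarith
    show "covers (v i) (d - 1) (G - ?R) (1 - 12*\<delta>)" if "i \<notin> P"
      using covers_goodsAt_reduction[OF _ dec d] ok that unfolding agent_ok_def by simp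
    show "sum (v i) ({1..m} - (G - ?R)) + psi ?y (v i) (G - ?R) (d - 1) \<le>
        (1 - 4*\<delta>) * (real n - real (d - 1)) + (1/2 + 6*\<delta>) * real (card P)" if P: "i \<in> P"
    proof -
      have RG: "?R \<subseteq> G" by (rule goodsAt_subset)
      have "{1..m} - (G - ?R) = ({1..m} - G) \<union> ?R" using RG G by auto
      then have "sum (v i) ({1..m} - (G - ?R)) = sum (v i) (({1..m} - G) \<union> ?R)" by simp
      also have "\<dots> = sum (v i) ({1..m} - G) + sum (v i) ?R"
        by (rule sum.union_disjoint) (use RG finG finite_subset in auto)
      finally have 1: "sum (v i) ({1..m} - (G - ?R)) = sum (v i) ({1..m} - G) + sum (v i) ?R" .
      have J: "?J \<subseteq> {2*d-1..}" using j d by auto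
      have 2: "sum (v i) ?R + psi ?y (v i) (G - ?R) (d - 1) =
          (\<Sum>p\<in>?J. min (?x p) ?y) + max 0 (?x (2*d-1) - ?y) + max 0 (?x (2*d) - ?y) + psi ?y (v i) G d"
        by (rule psi_removal[OF dec d]) (use J \<delta> in auto)
      have 3: "(\<Sum>p\<in>?J. min (?x p) ?y) + max 0 (?x (2*d-1) - ?y) + max 0 (?x (2*d) - ?y) \<le> 1 - 4*\<delta>"
        using j
      proof
        assume j2: "j = 2"
        have "(\<Sum>p\<in>?J. min (?x p) ?y) = min (?x (2*d-1)) ?y + min (?x (2*d)) ?y + min (?x (2*d+1)) ?y"
          unfolding j2 R2_positions[OF d, symmetric] by (rule sum_triple) (use d in auto)
        \<comment> \<open>The two goods with their excess are dominated by x(1) + x(2) < \<alpha>,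
          and the third capped value is at most 1/4 - 5\<delta>: in total 1 - 4\<delta>.\<close>
        moreover have "?x (2*d-1) \<le> ?x 1" "?x (2*d) \<le> ?x 2" using d by (auto intro!: anti)
        ultimately show ?thesis using pair by linarith
      next
        assume j3: "j = 3"
        have "(\<Sum>p\<in>?J. min (?x p) ?y) = min (?x (3*d-2)) ?y + min (?x (3*d-1)) ?y + min (?x (3*d)) ?y + min (?x (3*d+1)) ?y"
          unfolding j3 R3_positions[OF d, symmetric] by (rule sum_quadruple) (use d in auto)
        \<comment> \<open>This is where R2 must be inapplicable: the goods of R3 are dominated by
          those of R2, whose sum is below \<alpha>.\<close>
        moreover have "?x (3*d-2) \<le> ?x (2*d-1)" "?x (3*d-1) \<le> ?x (2*d)" "?x (3*d) \<le> ?x (2*d+1)"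
          using d by (auto intro!: anti)
        ultimately have "(\<Sum>p\<in>?J. min (?x p) ?y) + max 0 (?x (2*d-1) - ?y) + max 0 (?x (2*d) - ?y)
            \<le> ?x (2*d-1) + ?x (2*d) + ?x (2*d+1) + ?y"
          by (simp only:) (rule capped_sum_le)
        then show ?thesis using R2[OF j3] by simp
      qed
      have "sum (v i) ({1..m} - G) + psi ?y (v i) G d \<le> (1 - 4*\<delta>) * (real n - real d) + (1/2 + 6*\<delta>) * real (card P)"
        using ok P unfolding agent_ok_def by simp
      moreover have "real (d - 1) = real d - 1" using d by linarith
      ultimately show ?thesis using 1 2 3 by (simp add: algebra_simps)
    qed
  qed
qed

lemma inv_phase3_give:
  assumes inv: "inv_phase3 Ag G al" and i: "i \<in> Ag" and j: "j = 2 \<or> j = 3"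
    and S: "S = goodsAt G {j*(card Ag - 1)+1..j*card Ag+1}" and val: "\<alpha> \<le> val m v i S"
    and R2: "\<And>l. j = 3 \<Longrightarrow> l \<in> Ag \<Longrightarrow> val m v l (goodsAt G {2*card Ag-1, 2*card Ag, 2*card Ag+1}) < \<alpha>"
  shows "inv_phase3 (Ag - {i}) (G - S) (al(i := S))"
proof -
  have I: "Ag \<subseteq> {1..n}" "G \<subseteq> {1..m}" "alloc_ok n m v \<alpha> Ag al G" "\<And>l. l \<in> Ag \<Longrightarrow> agent_ok l G (card Ag)"
    using inv unfolding inv_phase3_def by auto
  have finAg: "finite Ag" using I(1) by (rule finite_subset) simp
  have cAg: "card (Ag - {i}) = card Ag - 1" "0 < card Ag" using i finAg by (auto simp: card_gt_0_iff)
  have SG: "S \<subseteq> G" unfolding S by (rule goodsAt_subset)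
  have "agent_ok l (G - S) (card (Ag - {i}))" if l: "l \<in> Ag - {i}" for l
    unfolding S cAg(1)
  proof (rule agent_ok_removal[OF _ _ I(2) cAg(2) j])
    show "agent_ok l G (card Ag)" "l \<in> {1..n}" using I l by auto
    show "pval (v l) G (2*card Ag-1) + pval (v l) G (2*card Ag) + pval (v l) G (2*card Ag+1) < \<alpha>" if "j = 3"
    proof -
      have "val m v l (goodsAt G {2*card Ag-1, 2*card Ag, 2*card Ag+1}) = (\<Sum>p\<in>{2*card Ag-1, 2*card Ag, 2*card Ag+1}. pval (v l) G p)"
        by (rule val_goodsAt[OF I(2)]) (use cAg in auto)
      also have "\<dots> = pval (v l) G (2*card Ag-1) + pval (v l) G (2*card Ag) + pval (v l) G (2*card Ag+1)"
        by (rule sum_triple) (use cAg in auto)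
      finally show ?thesis using R2[OF that, of l] l by simp
    qed
  qed
  moreover have "alloc_ok n m v \<alpha> (Ag - {i}) (al(i := S)) (G - S)"
    by (rule alloc_ok_give[OF I(3) i SG _ val]) (use SG I in auto)
  ultimately show ?thesis unfolding inv_phase3_def using I by auto
qed

end

section \<open>Phase 4: filling and handing out the bags\<close>

text \<open>\<open>G\<close> and N are frozen at the start of the phase, so \<open>ok\<close>,
  \<open>R2\<close> and \<open>R3\<close> persist. F holds the free goods, c is the current bag, and
  D keeps bags already given away, so that D and F always partition \<open>G\<close>.
  \<open>fill\<close> concerns only agents still present, who were asked at every addition.\<close>

locale phase4 = ONI_instance +
  fixes G Ag F :: "nat set" and al D :: "nat \<Rightarrow> nat set" and N c :: nat
  assumes Ag: "Ag \<subseteq> {1..n}" and G: "G \<subseteq> {1..m}"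
    and c1: "1 \<le> c" and card_Ag: "card Ag + c = N + 1"
    and init: "k \<in> {1..N} \<Longrightarrow> goodsAt G {k, 2*N-k+1, 2*N+k} \<subseteq> D k"
    and ext: "k \<in> {1..N} \<Longrightarrow> D k - goodsAt G {k, 2*N-k+1, 2*N+k} \<subseteq> G - goodsAt G {1..3*N}"
    and free: "k \<in> {1..N} \<Longrightarrow> D k \<inter> F = {}"
    and disj: "k \<in> {1..N} \<Longrightarrow> l \<in> {1..N} \<Longrightarrow> k \<noteq> l \<Longrightarrow> D k \<inter> D l = {}"
    and union: "(\<Union>k\<in>{1..N}. D k) \<union> F = G"
    and free_top: "F \<inter> goodsAt G {1..3*N} = {}"
    and ok: "i \<in> Ag \<Longrightarrow> agent_ok i G N"
    and R2: "i \<in> Ag \<Longrightarrow> pval (v i) G (2*N-1) + pval (v i) G (2*N) + pval (v i) G (2*N+1) < 3/4 + \<delta>"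
    and R3: "i \<in> Ag \<Longrightarrow>
       pval (v i) G (3*N-2) + pval (v i) G (3*N-1) + pval (v i) G (3*N) + pval (v i) G (3*N+1) < 3/4 + \<delta>"
    and fill: "i \<in> Ag \<Longrightarrow> k \<in> {1..N} \<Longrightarrow> D k = goodsAt G {k, 2*N-k+1, 2*N+k} \<or>
       (\<exists>l\<in>D k - goodsAt G {k, 2*N-k+1, 2*N+k}. sum (v i) (D k - {l}) < 3/4 + \<delta>)"
    and alloc: "alloc_ok n m v (3/4 + \<delta>) Ag al (F \<union> (\<Union>k\<in>{c..N}. D k))"
begin

abbreviation C where "C k \<equiv> goodsAt G {k, 2*N-k+1, 2*N+k}"

lemma D_sub: "k \<in> {1..N} \<Longrightarrow> D k \<subseteq> {1..m}"
  using union G by blast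

lemma add_good:
  assumes c: "c \<le> N" and g: "g \<in> F" and low: "\<And>j. j \<in> Ag \<Longrightarrow> val m v j (D c) < \<alpha>"
  shows "phase4 n m v \<delta> G Ag (F - {g}) al (D(c := insert g (D c))) N c"
proof
  let ?D = "D(c := insert g (D c))"
  have cN: "c \<in> {1..N}" using c1 c by auto
  have gD: "g \<notin> D k" if "k \<in> {1..N}" for k using free[OF that] g by blast
  have gG: "g \<in> G - goodsAt G {1..3*N}" using union free_top g by blast
  show "Ag \<subseteq> {1..n}" "G \<subseteq> {1..m}" "1 \<le> c" "card Ag + c = N + 1" by (fact Ag G c1 card_Ag)+
  show "C k \<subseteq> ?D k" if "k \<in> {1..N}" for k using init[OF that] by auto
  show "?D k - C k \<subseteq> G - goodsAt G {1..3*N}" if "k \<in> {1..N}" for k using ext[OF that] gG by auto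
  show "?D k \<inter> (F - {g}) = {}" if "k \<in> {1..N}" for k using free[OF that] by auto
  show "?D k \<inter> ?D l = {}" if "k \<in> {1..N}" "l \<in> {1..N}" "k \<noteq> l" for k l
    using disj[OF that] gD[OF that(1)] gD[OF that(2)] that(3) by auto
  have "(\<Union>k\<in>{1..N}. ?D k) = insert g (\<Union>k\<in>{1..N}. D k)" using cN by (auto split: if_splits)
  then have "(\<Union>k\<in>{1..N}. ?D k) \<union> (F - {g}) = (\<Union>k\<in>{1..N}. D k) \<union> F" using g by auto
  then show "(\<Union>k\<in>{1..N}. ?D k) \<union> (F - {g}) = G" by (simp only: union)
  show "(F - {g}) \<inter> goodsAt G {1..3*N} = {}" using free_top by blast
  show "?D k = C k \<or> (\<exists>l\<in>?D k - C k. sum (v i) (?D k - {l}) < \<alpha>)"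
    if i: "i \<in> Ag" and k: "k \<in> {1..N}" for i k
  proof (cases "k = c")
    case True
    have "g \<notin> C c" using init[OF cN] gD[OF cN] by blast
    moreover have "insert g (D c) - {g} = D c" using gD[OF cN] by auto
    moreover have "sum (v i) (D c) < \<alpha>" using low[OF i] val_sum[OF D_sub[OF cN]] by simp
    ultimately have "\<exists>l\<in>?D c - C c. sum (v i) (?D c - {l}) < \<alpha>" by (intro bexI[of _ g]) auto
    then show ?thesis using True by blast
  next
    case False
    then show ?thesis using fill[OF i k] by simp
  qed
  have "(\<Union>k\<in>{c..N}. ?D k) = insert g (\<Union>k\<in>{c..N}. D k)" using c by (auto split: if_splits)
  then have "F - {g} \<union> (\<Union>k\<in>{c..N}. ?D k) \<subseteq> F \<union> (\<Union>k\<in>{c..N}. D k)" using g by auto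
  then show "alloc_ok n m v \<alpha> Ag al (F - {g} \<union> (\<Union>k\<in>{c..N}. ?D k))"
    by (rule alloc_ok_mono[OF alloc])
qed (use ok R2 R3 in auto)

lemma give_bag:
  assumes c: "c \<le> N" and i: "i \<in> Ag" and val: "\<alpha> \<le> val m v i (D c)"
  shows "phase4 n m v \<delta> G (Ag - {i}) (F - D c) (al(i := D c)) D N (c + 1)"
proof -
  have cN: "c \<in> {1..N}" using c1 c by auto
  \<comment> \<open>The state update also subtracts the bag from the free goods, which changes
    nothing here.\<close>
  have FD: "F - D c = F" using free[OF cN] by blast
  have finAg: "finite Ag" using Ag by (rule finite_subset) simp
  have card': "card (Ag - {i}) + (c + 1) = N + 1"
    using card_Suc_Diff1[OF finAg i] card_Ag by simp
  have "D c \<inter> D k = {}" if "k \<in> {c+1..N}" for k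
    using disj[OF cN, of k] that by auto
  then have sub: "F \<union> (\<Union>k\<in>{c+1..N}. D k) \<subseteq> F \<union> (\<Union>k\<in>{c..N}. D k) - D c" using FD by fastforce
  have alloc': "alloc_ok n m v \<alpha> (Ag - {i}) (al(i := D c)) (F \<union> (\<Union>k\<in>{c+1..N}. D k))"
    by (rule alloc_ok_give[OF alloc i _ D_sub[OF cN] val sub]) (use c in auto)
  show ?thesis unfolding FD
  proof
    show "Ag - {i} \<subseteq> {1..n}" using Ag by auto
    show "1 \<le> c + 1" by simp
    fix j assume "j \<in> Ag - {i}"
    then have j: "j \<in> Ag" by simp
    show "agent_ok j G N"
      "pval (v j) G (2*N-1) + pval (v j) G (2*N) + pval (v j) G (2*N+1) < \<alpha>"
      "pval (v j) G (3*N-2) + pval (v j) G (3*N-1) + pval (v j) G (3*N) + pval (v j) G (3*N+1) < \<alpha>"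
      by (fact ok[OF j] R2[OF j] R3[OF j])+
    show "D k = C k \<or> (\<exists>l\<in>D k - C k. sum (v j) (D k - {l}) < \<alpha>)" if "k \<in> {1..N}" for k
      by (fact fill[OF j that])
  qed (fact G card' init ext free disj union free_top alloc')+
qed

lemma not_stuck:
  assumes F: "F = {}" and c: "c \<le> N" and low: "\<And>j. j \<in> Ag \<Longrightarrow> val m v j (D c) < \<alpha>"
  shows False
proof -
  have cN: "c \<in> {1..N}" using c1 c by auto
  have "Ag \<noteq> {}" using card_Ag c by auto
  then obtain i where i: "i \<in> Ag" by auto
  then have iN: "i \<in> {1..n}" using Ag by auto
  have fail: "sum (v i) (D c) < \<alpha>" using low[OF i] val_sum[OF D_sub[OF cN]] by simp
  interpret bf: bag_filling "v i" G N c D \<delta>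
  proof
    show "pval (v i) G 1 + pval (v i) G 2 < \<alpha>" using ok[OF i] unfolding agent_ok_def by blast
    show "(\<Union>k\<in>{1..N}. D k) = G" using union F by simp
  qed (fact \<delta> v_decr[OF iN G] cN init ext disj fill[OF i] fail R2[OF i] R3[OF i])+
  show False
  proof (cases "i \<in> P")
    case False
    then show False using bf.covers_imp_False ok[OF i] unfolding agent_ok_def by blast
  next
    case True
    have "sum (v i) {1..m} = sum (v i) ({1..m} - G) + sum (v i) G"
      by (rule sum.subset_diff) (use G in auto)
    moreover have "sum (v i) ({1..m} - G) + psi (1/4 - 5*\<delta>) (v i) G N \<le>
        (1 - 4*\<delta>) * (real n - real N) + (1/2 + 6*\<delta>) * real (card P)"
      using ok[OF i] True unfolding agent_ok_def by blast
    ultimately have "real n \<le> (1 - 4*\<delta>) * (real n - real N) + (1/2 + 6*\<delta>) * real (card P) + real N * (1 - 4*\<delta>)"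
      using total_value[OF iN] bf.total_value_le unfolding psi_def by linarith
    then have 1: "real n * (4*\<delta>) \<le> (1/2 + 6*\<delta>) * real (card P)" by (simp add: algebra_simps)
    \<comment> \<open>The factor 3/4 + \<delta> = 3(1/4 + \<delta>/3) is the one that matches
      \<open>card_P\<close>; the extra cost stays below 4\<delta>n, the slack of n agents at 1 -
      4\<delta> each.\<close>
    have "(1/2 + 6*\<delta>) * real (card P) \<le> (3/4 + \<delta>) * real (card P)"
      using \<delta> by (intro mult_right_mono) auto
    also have "\<dots> = 3 * (real (card P) * (1/4 + \<delta>/3))" by (simp add: algebra_simps)
    also have "\<dots> < 3 * (real n * (4/3 * \<delta>))" using card_P by linarith
    finally show False using 1 by (simp add: algebra_simps)
  qed
qed

end

section \<open>The invariant of the whole run, termination and the final allocation\<close>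

context ONI_instance
begin

lemma inv_phase3_imp_phase4:
  assumes invariant: "inv_phase3 Ag G al" and N: "N = card Ag"
    and R2: "\<And>j. j \<in> Ag \<Longrightarrow> val m v j (goodsAt G {2*N-1, 2*N, 2*N+1}) < \<alpha>"
    and R3: "\<And>j. j \<in> Ag \<Longrightarrow> val m v j (goodsAt G {3*N-2, 3*N-1, 3*N, 3*N+1}) < \<alpha>"
  shows "phase4 n m v \<delta> G Ag (G - goodsAt G {1..3*N}) al (\<lambda>k. goodsAt G {k, 2*N-k+1, 2*N+k}) N 1"
proof -
  have I: "Ag \<subseteq> {1..n}" "G \<subseteq> {1..m}" "alloc_ok n m v \<alpha> Ag al G" "\<And>l. l \<in> Ag \<Longrightarrow> agent_ok l G (card Ag)"
    using invariant unfolding inv_phase3_def by auto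
  let ?C = "\<lambda>k. goodsAt G {k, 2*N-k+1, 2*N+k}"
  have sub: "?C k \<subseteq> goodsAt G {1..3*N}" if "k \<in> {1..N}" for k
    by (rule goodsAt_mono) (use that in auto)
  have disj: "?C k \<inter> ?C l = {}" if "k \<in> {1..N}" "l \<in> {1..N}" "k \<noteq> l" for k l
    by (rule goodsAt_disjoint) (use that in auto)
  have un: "(\<Union>k\<in>{1..N}. ?C k) = goodsAt G {1..3*N}"
  proof (rule antisym)
    show "(\<Union>k\<in>{1..N}. ?C k) \<subseteq> goodsAt G {1..3*N}" using sub by blast
    show "goodsAt G {1..3*N} \<subseteq> (\<Union>k\<in>{1..N}. ?C k)"
    proof
      fix g assume "g \<in> goodsAt G {1..3*N}"
      then obtain p where p: "g = pos G p" "p \<in> {1..3*N}" "p \<in> {1..card G}" unfolding goodsAt_pos by auto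
      \<comment> \<open>Positions 1..N run upwards through the bags, N+1..2N downwards, and 2N+1..3N
        upwards again.\<close>
      define k where "k = (if p \<le> N then p else if p \<le> 2*N then 2*N+1-p else p-2*N)"
      have "k \<in> {1..N}" "p \<in> {k, 2*N-k+1, 2*N+k}" using p unfolding k_def by auto
      moreover from this have "g \<in> ?C k" using p unfolding goodsAt_pos by blast
      ultimately show "g \<in> (\<Union>k\<in>{1..N}. ?C k)" by blast
    qed
  qed
  have vals: "pval (v i) G (2*N-1) + pval (v i) G (2*N) + pval (v i) G (2*N+1) < \<alpha>"
     "pval (v i) G (3*N-2) + pval (v i) G (3*N-1) + pval (v i) G (3*N) + pval (v i) G (3*N+1) < \<alpha>" if i: "i \<in> Ag" for i
  proof -
    have "finite Ag" using I(1) by (rule finite_subset) simp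
    then have N0: "0 < N" using i N by (auto simp: card_gt_0_iff)
    have "val m v i (goodsAt G {2*N-1, 2*N, 2*N+1}) = (\<Sum>p\<in>{2*N-1, 2*N, 2*N+1}. pval (v i) G p)"
      by (rule val_goodsAt[OF I(2)]) (use N0 in auto)
    also have "\<dots> = pval (v i) G (2*N-1) + pval (v i) G (2*N) + pval (v i) G (2*N+1)"
      by (rule sum_triple) (use N0 in auto)
    finally show "pval (v i) G (2*N-1) + pval (v i) G (2*N) + pval (v i) G (2*N+1) < \<alpha>"
      using R2[OF i] by linarith
    have "val m v i (goodsAt G {3*N-2, 3*N-1, 3*N, 3*N+1}) = (\<Sum>p\<in>{3*N-2, 3*N-1, 3*N, 3*N+1}. pval (v i) G p)"
      by (rule val_goodsAt[OF I(2)]) (use N0 in auto)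
    also have "\<dots> = pval (v i) G (3*N-2) + pval (v i) G (3*N-1) + pval (v i) G (3*N) + pval (v i) G (3*N+1)"
      by (rule sum_quadruple) (use N0 in auto)
    finally show "pval (v i) G (3*N-2) + pval (v i) G (3*N-1) + pval (v i) G (3*N) + pval (v i) G (3*N+1) < \<alpha>"
      using R3[OF i] by linarith
  qed
  have al: "alloc_ok n m v \<alpha> Ag al (G - goodsAt G {1..3*N} \<union> (\<Union>k\<in>{1..N}. ?C k))"
    by (rule alloc_ok_mono[OF I(3)]) (use goodsAt_subset in blast)
  show ?thesis
  proof
    show "card Ag + 1 = N + 1" using N by simp
    show "(\<Union>k\<in>{1..N}. ?C k) \<union> (G - goodsAt G {1..3*N}) = G"
      unfolding un using goodsAt_subset[of G "{1..3*N}"] by blast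
    show "?C k \<inter> (G - goodsAt G {1..3*N}) = {}" if "k \<in> {1..N}" for k using sub[OF that] by blast
    show "alloc_ok n m v \<alpha> Ag al (G - goodsAt G {1..3*N} \<union> (\<Union>k\<in>{1..N}. ?C k))" by (fact al)
    show "agent_ok i G N" if "i \<in> Ag" for i using I(4)[OF that] N by simp
    show "?C k \<inter> ?C l = {}" if "k \<in> {1..N}" "l \<in> {1..N}" "k \<noteq> l" for k l by (fact disj[OF that])
  qed (use I vals in auto)
qed

text \<open>The state does not record the goods present when phase 4 began, hence the existential
  quantifier.\<close>

definition inv_phase4 :: "nat set \<Rightarrow> nat set \<Rightarrow> (nat \<Rightarrow> nat set) \<Rightarrow> (nat \<Rightarrow> nat set) \<Rightarrow> nat \<Rightarrow> nat \<Rightarrow> bool" where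
  "inv_phase4 Ag F al D N c \<longleftrightarrow> (\<exists>G. phase4 n m v \<delta> G Ag F al D N c)"

definition invariant :: "state \<Rightarrow> bool" where
  "invariant s \<longleftrightarrow>
     (phase s = 1 \<and> inv_phase12 (agents s) (goods s) (alloc s) \<and> bags s \<subseteq> {1..n} \<and> (\<forall>k\<in>bags s. Bbag n m k \<subseteq> goods s)) \<or>
     (phase s = 2 \<and> inv_phase12 (agents s) (goods s) (alloc s)) \<or>
     (phase s = 3 \<and> inv_phase3 (agents s) (goods s) (alloc s)) \<or>
     (phase s = 4 \<and> inv_phase4 (agents s) (goods s) (alloc s) (cbags s) (np s) (cur s)) \<or>
     (phase s = 5 \<and> agents s = {} \<and> alloc_ok n m v \<alpha> {} (alloc s) {})"

lemma inv_init: "invariant (init_state n m)"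
proof -
  have "{1..m} \<inter> {1..2*n} = {1..2*n}" using m_ge by auto
  moreover have "0 \<le> (1/2 + 6*\<delta>) * real (card (P - {1..n}))" using \<delta> by simp
  ultimately show ?thesis
    unfolding invariant_def inv_phase12_def alloc_ok_def init_state_def using \<delta> by (auto simp: Bbag_def)
qed

lemma inv_step:
  assumes "step n m v \<delta> s s'" "invariant s"
  shows "invariant s'"
  using assms
proof (cases rule: step.cases)
  case (p1_give i k)
  have I: "inv_phase12 (agents s) (goods s) (alloc s)" "bags s \<subseteq> {1..n}" "\<forall>k\<in>bags s. Bbag n m k \<subseteq> goods s"
    using assms(2) p1_give(2) unfolding invariant_def by auto
  have k: "k \<in> {1..n}" using p1_give I by auto
  have "inv_phase12 (agents s - {i}) (goods s - Bbag n m k) ((alloc s)(i := Bbag n m k))"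
  proof (rule inv_phase12_give[OF I(1) p1_give(3)])
    show "Bbag n m k \<subseteq> goods s" using I p1_give by auto
    show "Bbag n m k \<subseteq> {1..2*n}" using k unfolding Bbag_eq[OF k] by auto
    show "card (Bbag n m k) = 2" using k unfolding Bbag_eq[OF k] by (auto simp: card_insert_if)
    show "\<alpha> \<le> val m v i (Bbag n m k)" using p1_give by simp
    show "val m v j (Bbag n m k) < \<alpha>" if "j \<in> agents s \<inter> P" "i \<notin> P" for j
      using p1_give(4,6) that by (meson not_le)
  qed
  moreover have "Bbag n m k' \<subseteq> goods s - Bbag n m k" if k': "k' \<in> bags s - {k}" for k'
  proof -
    have "k' \<in> {1..n}" using k' I by auto
    then have "Bbag n m k' \<inter> Bbag n m k = {}" using k k' by (auto simp: Bbag_eq)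
    then show ?thesis using I k' by blast
  qed
  ultimately show ?thesis using p1_give I unfolding invariant_def by (auto simp: give_def)
next
  case p1_end
  then show ?thesis using assms(2) unfolding invariant_def by auto
next
  case (p2_give i)
  have I: "inv_phase12 (agents s) (goods s) (alloc s)" using assms(2) p2_give(2) unfolding invariant_def by auto
  let ?S = "goodsAt (goods s) {1,2}"
  have J: "agents s \<subseteq> {1..n}" "card (goods s \<inter> {1..2*n}) = 2 * card (agents s)" "goods s \<subseteq> {1..m}"
    using I unfolding inv_phase12_def by auto
  have fin: "finite (agents s)" using J(1) by (rule finite_subset) simp
  then have c: "0 < card (agents s)" using p2_give by (auto simp: card_gt_0_iff)
  have sub: "?S \<subseteq> goods s \<inter> {1..2*n}"
    unfolding inv_phase12_top[OF I, symmetric] by (rule goodsAt_mono) (use c in auto)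
  have "finite (goods s)" using J(3) by (rule finite_subset) simp
  then have "card (goods s \<inter> {1..2*n}) \<le> card (goods s)" by (intro card_mono) auto
  then have "{1,2} \<inter> {1..card (goods s)} = {1,2}" using J c by auto
  then have card2: "card ?S = 2" unfolding card_goodsAt by simp
  have "inv_phase12 (agents s - {i}) (goods s - ?S) ((alloc s)(i := ?S))"
  proof (rule inv_phase12_give[OF I p2_give(3)])
    show "?S \<subseteq> goods s" "?S \<subseteq> {1..2*n}" "card ?S = 2" using sub card2 by auto
    show "\<alpha> \<le> val m v i ?S" using p2_give by simp
    show "val m v j ?S < \<alpha>" if "j \<in> agents s \<inter> P" "i \<notin> P" for j
      using p2_give(5) that by (meson not_le)
  qed
  then show ?thesis using p2_give unfolding invariant_def by (auto simp: give_def)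
next
  case p2_end
  have I: "inv_phase12 (agents s) (goods s) (alloc s)" using assms(2) p2_end unfolding invariant_def by auto
  have "inv_phase3 (agents s) (goods s) (alloc s)"
    by (rule inv_phase12_imp_inv3[OF I]) (use p2_end in \<open>meson not_le\<close>)
  then show ?thesis using p2_end unfolding invariant_def by auto
next
  case (p3_R2 i n')
  have I: "inv_phase3 (agents s) (goods s) (alloc s)" using assms(2) p3_R2 unfolding invariant_def by auto
  then have "agents s \<subseteq> {1..n}" unfolding inv_phase3_def by simp
  then have "finite (agents s)" by (rule finite_subset) simp
  then have "0 < n'" using p3_R2 by (auto simp: card_gt_0_iff)
  then have S: "{2*n'-1, 2*n', 2*n'+1} = {2*(card (agents s) - 1)+1..2*card (agents s)+1}"
    using R2_positions p3_R2(4) by simp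
  have "inv_phase3 (agents s - {i}) (goods s - goodsAt (goods s) {2*n'-1, 2*n', 2*n'+1})
     ((alloc s)(i := goodsAt (goods s) {2*n'-1, 2*n', 2*n'+1}))"
    by (rule inv_phase3_give[OF I p3_R2(3), of 2]) (use p3_R2 S in auto)
  then show ?thesis using p3_R2 unfolding invariant_def by (auto simp: give_def)
next
  case (p3_R3 i n')
  have I: "inv_phase3 (agents s) (goods s) (alloc s)" using assms(2) p3_R3 unfolding invariant_def by auto
  then have "agents s \<subseteq> {1..n}" unfolding inv_phase3_def by simp
  then have "finite (agents s)" by (rule finite_subset) simp
  then have "0 < n'" using p3_R3 by (auto simp: card_gt_0_iff)
  then have S: "{3*n'-2, 3*n'-1, 3*n', 3*n'+1} = {3*(card (agents s) - 1)+1..3*card (agents s)+1}"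
    using R3_positions p3_R3(4) by simp
  have "inv_phase3 (agents s - {i}) (goods s - goodsAt (goods s) {3*n'-2, 3*n'-1, 3*n', 3*n'+1})
     ((alloc s)(i := goodsAt (goods s) {3*n'-2, 3*n'-1, 3*n', 3*n'+1}))"
  proof (rule inv_phase3_give[OF I p3_R3(3), of 3])
    show "val m v l (goodsAt (goods s) {2*card (agents s)-1, 2*card (agents s), 2*card (agents s)+1}) < \<alpha>"
      if "l \<in> agents s" for l using p3_R3(4,5) that by (meson not_le)
  qed (use p3_R3 S in auto)
  then show ?thesis using p3_R3 unfolding invariant_def by (auto simp: give_def)
next
  case (p3_end n')
  have I: "inv_phase3 (agents s) (goods s) (alloc s)" using assms(2) p3_end unfolding invariant_def by auto
  have "inv_phase4 (agents s) (goods s - goodsAt (goods s) {1..3*n'}) (alloc s)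
     (\<lambda>k. goodsAt (goods s) {k, 2*n'-k+1, 2*n'+k}) n' 1"
    unfolding inv_phase4_def
    by (rule exI, rule inv_phase3_imp_phase4[OF I p3_end(3)]) (use p3_end(4,5) in \<open>meson not_le\<close>)+
  then show ?thesis using p3_end unfolding invariant_def by auto
next
  case (p4_add g)
  have I: "inv_phase4 (agents s) (goods s) (alloc s) (cbags s) (np s) (cur s)" using assms(2) p4_add(2) unfolding invariant_def by auto
  have "inv_phase4 (agents s) (goods s - {g}) (alloc s) ((cbags s)(cur s := insert g (cbags s (cur s)))) (np s) (cur s)"
  proof -
    obtain G where G: "phase4 n m v \<delta> G (agents s) (goods s) (alloc s) (cbags s) (np s) (cur s)"
      using I unfolding inv_phase4_def by blast
    show ?thesis unfolding inv_phase4_def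
      by (rule exI[of _ G], rule phase4.add_good[OF G p4_add(3) p4_add(5)]) (use p4_add(4) in \<open>auto simp: not_le\<close>)
  qed
  then show ?thesis using p4_add unfolding invariant_def by auto
next
  case (p4_give i)
  have I: "inv_phase4 (agents s) (goods s) (alloc s) (cbags s) (np s) (cur s)" using assms(2) p4_give(2) unfolding invariant_def by auto
  have "inv_phase4 (agents s - {i}) (goods s - cbags s (cur s)) ((alloc s)(i := cbags s (cur s))) (cbags s) (np s) (cur s + 1)"
  proof -
    obtain G where G: "phase4 n m v \<delta> G (agents s) (goods s) (alloc s) (cbags s) (np s) (cur s)"
      using I unfolding inv_phase4_def by blast
    show ?thesis unfolding inv_phase4_def
      by (rule exI[of _ G], rule phase4.give_bag[OF G p4_give(3,4,5)])
  qed
  then show ?thesis using p4_give unfolding invariant_def by (auto simp: give_def)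
next
  case p4_end
  have I: "inv_phase4 (agents s) (goods s) (alloc s) (cbags s) (np s) (cur s)" using assms(2) p4_end(2) unfolding invariant_def by auto
  then obtain G where G: "phase4 n m v \<delta> G (agents s) (goods s) (alloc s) (cbags s) (np s) (cur s)"
    unfolding inv_phase4_def by blast
  note J = phase4.Ag[OF G] phase4.card_Ag[OF G] phase4.alloc[OF G]
  have "finite (agents s)" using J(1) by (rule finite_subset) simp
  moreover have "card (agents s) = 0" using J p4_end by simp
  ultimately have "agents s = {}" by simp
  moreover have "alloc_ok n m v \<alpha> (agents s) (alloc s) {}" by (rule alloc_ok_mono[OF J(3)]) simp
  ultimately show ?thesis using p4_end unfolding invariant_def by simp
qed

lemma inv_finite:
  assumes "invariant s" "phase s \<le> 4"
  shows "finite (agents s)" "finite (goods s)"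
proof -
  have "agents s \<subseteq> {1..n} \<and> goods s \<subseteq> {1..m}"
  proof (cases "phase s = 4")
    case True
    then obtain G where G: "phase4 n m v \<delta> G (agents s) (goods s) (alloc s) (cbags s) (np s) (cur s)"
      using assms unfolding invariant_def inv_phase4_def by auto
    show ?thesis using phase4.Ag[OF G] phase4.G[OF G] phase4.union[OF G] by blast
  next
    case False
    then show ?thesis using assms unfolding invariant_def inv_phase12_def inv_phase3_def by auto
  qed
  then show "finite (agents s)" "finite (goods s)" by (meson finite_atLeastAtMost finite_subset)+
qed

text \<open>Giving removes an agent, adding a good removes a free good, and ending a phase lowers
  the last summand.\<close>

definition rank :: "state \<Rightarrow> nat" where
  "rank s = card (agents s) + card (goods s) + (5 - phase s)"

lemma rank_give:
  assumes "finite (agents s)" "finite (goods s)" "i \<in> agents s"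
  shows "card (agents s - {i}) + card (goods s - S) < card (agents s) + card (goods s)"
  using card_Diff1_less[OF assms(1,3)] card_mono[OF assms(2), of "goods s - S"] by (intro add_less_le_mono) auto

lemma rank_decreases:
  assumes "step n m v \<delta> s s'" "invariant s"
  shows "rank s' < rank s"
proof -
  have "phase s \<le> 4" using assms(1) by (cases rule: step.cases) auto
  note fin = inv_finite[OF assms(2) this]
  show ?thesis using assms(1)
  proof (cases rule: step.cases)
    case (p3_end n')
    have "card (goods s - goodsAt (goods s) {1..3*n'}) \<le> card (goods s)" by (rule card_mono) (use fin in auto)
    then show ?thesis using p3_end by (simp add: rank_def)
  next
    case (p4_add g)
    then show ?thesis using card_Diff1_less[OF fin(2) p4_add(5)] by (simp add: rank_def)
  qed (use rank_give[OF fin] in \<open>force simp: rank_def give_def\<close>)+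
qed

lemma inv_stuck:
  assumes "invariant s" "\<nexists>s'. step n m v \<delta> s s'"
  shows "phase s = 5"
proof (rule ccontr)
  assume n5: "phase s \<noteq> 5"
  have no: "\<not> step n m v \<delta> s s'" for s' using assms(2) by blast
  consider "phase s = 1" | "phase s = 2" | "phase s = 3" | "phase s = 4" using assms(1) n5 unfolding invariant_def by auto
  then show False
  proof cases
    case 1
    have "\<exists>i\<in>agents s. \<exists>k\<in>bags s. \<alpha> \<le> val m v i (Bbag n m k)" using p1_end[OF 1] no by blast
    \<comment> \<open>The priority condition never blocks: take a qualifying priority agent if there
      is one, otherwise any qualifying agent.\<close>
    then show False using p1_give[OF 1] no by (metis IntE)
  next
    case 2
    have "\<exists>i\<in>agents s. \<alpha> \<le> val m v i (goodsAt (goods s) {1,2})" using p2_end[OF 2] no by blast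
    then show False using p2_give[OF 2] no by (metis IntE)
  next
    case 3
    let ?N = "card (agents s)"
    have a: "\<not> (\<exists>j\<in>agents s. val m v j (goodsAt (goods s) {2*?N-1, 2*?N, 2*?N+1}) \<ge> \<alpha>)"
      using p3_R2[OF 3 _ refl] no by blast
    moreover have "\<not> (\<exists>j\<in>agents s. val m v j (goodsAt (goods s) {3*?N-2, 3*?N-1, 3*?N, 3*?N+1}) \<ge> \<alpha>)"
      using p3_R3[OF 3 _ refl a] no by blast
    ultimately show False using p3_end[OF 3 refl] no by blast
  next
    case 4
    have I: "inv_phase4 (agents s) (goods s) (alloc s) (cbags s) (np s) (cur s)" using assms(1) 4 unfolding invariant_def by auto
    have c: "cur s \<le> np s" using p4_end[OF 4] no by (meson not_le)
    have low: "\<not> (\<exists>j\<in>agents s. \<alpha> \<le> val m v j (cbags s (cur s)))"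
      using p4_give[OF 4 c] no by (metis IntE)
    then have "goods s = {}" using p4_add[OF 4 c] no by blast
    moreover obtain G where "phase4 n m v \<delta> G (agents s) (goods s) (alloc s) (cbags s) (np s) (cur s)"
      using I unfolding inv_phase4_def by blast
    ultimately show False using phase4.not_stuck c low by (meson not_le)
  qed
qed

lemma inv_reachable: "(step n m v \<delta>)\<^sup>*\<^sup>* (init_state n m) s \<Longrightarrow> invariant s"
  by (induction rule: rtranclp_induct) (auto intro: inv_init inv_step)

lemma terminates: "\<nexists>f. f 0 = init_state n m \<and> (\<forall>j. step n m v \<delta> (f j) (f (Suc j)))"
proof
  assume "\<exists>f. f 0 = init_state n m \<and> (\<forall>j. step n m v \<delta> (f j) (f (Suc j)))"
  then obtain f where f: "f 0 = init_state n m" "\<And>j. step n m v \<delta> (f j) (f (Suc j))" by blast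
  have I: "invariant (f j)" for j by (induction j) (auto simp: f inv_init intro: inv_step[OF f(2)])
  have "rank (f j) + j \<le> rank (f 0)" for j
  proof (induction j)
    case (Suc j)
    then show ?case using rank_decreases[OF f(2)[of j] I] by simp
  qed simp
  from this[of "Suc (rank (f 0))"] show False by simp
qed

lemma final_allocation:
  assumes "invariant s" "phase s = 5"
  shows "beta_MMS n m v \<alpha> (alloc s)"
proof -
  have "alloc_ok n m v \<alpha> {} (alloc s) {}" using assms unfolding invariant_def by auto
  then show ?thesis unfolding beta_MMS_def is_allocation_def alloc_ok_def using MMS_one by simp
qed

end

text \<open>Arbitrary choices are the nondeterminism of \<open>step\<close>: no run is infinite, and
  any state where a run can stop is a finished one with the desired allocation.\<close>

theorem theorem45:
  fixes n m :: nat and v :: valuation and \<delta> :: real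
  assumes "0 \<le> \<delta>" and "\<delta> \<le> 3/956"
    and "nonneg_additive n m v"
    and "ONI n m v \<delta>"
    and "real (card (N11 n m v \<delta>)) > real n * (1/4 - \<delta>) / (1/4 + \<delta>/3)"
  shows "(\<nexists>f. f 0 = init_state n m \<and> (\<forall>j. step n m v \<delta> (f j) (f (Suc j))))
     \<and> (\<forall>s. (step n m v \<delta>)\<^sup>*\<^sup>* (init_state n m) s \<and> (\<nexists>s'. step n m v \<delta> s s')
            \<longrightarrow> phase s = 5 \<and> beta_MMS n m v (3/4 + \<delta>) (alloc s))"
proof -
  interpret ONI_instance n m v \<delta> using assms by unfold_locales
  show ?thesis using terminates inv_reachable inv_stuck final_allocation by blast
qed

end
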